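(* Let $p,q\ge 1$ be integers and let $G$ be a graph with maximum degree $\Delta$ and multiplicity $\mu$. Then: \begin{enumerate} \item if $G$ is an interval $k$-graph, then $\lambda_{p,q}(G)\le 2(p+q-1)\Delta-2q+1$; \item if $G$ is an interval graph, then $\lambda_{p,q}(G)\le \max\{p,q\}\Delta$; \item if $G$ is a circular-arc graph, then $\lambda_{p,q}(G)\le 3\max\{p,q\}\Delta+p$; \item if $G$ is a permutation graph, then $\lambda_{p,q}(G)\le 2(p+q-1)\Delta-2q+1$; \item if $G$ is a cointerval graph, then $\lambda_{p,q}(G)\le (2p-1)\Delta+(2q-1)(\mu-1)$. \end{enumerate}
   Context: All graphs are simple. For a graph $G=(V,E)$: $N_G(v)$ is the set of neighbors of $v$; $\Delta=\Delta(G)$ is the maximum degree; $d_G(u,v)$ is the length of a shortest path between $u$ and $v$; for distinct $u,v\in V$, $m_G(u,v)=|N_G(u)\cap N_G(v)|$, and the multiplicity of $G$ is $\mu=\mu(G)=\max\{m_G(u,v): u,v\in V,\ u\ne v\}$. An $L(p,q)$-labeling of $G$ is a function $f:V\to\{0,1,2,\dots\}$ with $|f(u)-f(v)|\ge p$ whenever $uv\in E$ and $|f(u)-f(v)|\ge q$ whenever $d_G(u,v)=2$. Its span is the difference between the largest and the smallest label used. $\lambda_{p,q}(G)$ is the least integer $k$ such that $G$ has an $L(p,q)$-labeling with span $k$. Graph classes. $G$ is an interval graph if each vertex $v$ can be assigned a closed interval $I_v$ of the real line so that distinct $u,v$ are adjacent iff $I_u\cap I_v\ne\emptyset$. $G$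 is an interval $k$-graph if each vertex $v$ can be assigned a pair $(I_v,\kappa(v))$, with $I_v$ a closed interval of the real line and $\kappa(v)\in\{1,\dots,k\}$, so that $uv\in E$ iff $I_u\cap I_v\neq\emptyset$ and $\kappa(u)\ne\kappa(v)$. $G$ is a circular-arc graph if it is the intersection graph of arcs on a circle. $G$ is a permutation graph if each vertex $v$ can be assigned a closed interval $I_v$ of the real line so that distinct $u,v$ are adjacent iff $I_u\subseteq I_v$ or $I_v\subseteq I_u$. $G$ is a cointerval graph if its complement is an interval graph.
   Formalization: Items 1 and 4 are proved for Δ ≥ 1, and item 5 for μ ≥ 1 and q < 2p: edgeless graphs make these bounds negative, item 5 fails for K_2 with p = q = 1, and for q ≥ 2p it fails for large stars K_{1,n} (e.g. p = 1, q = 2, n = 3). *)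

theory Defs
  imports "Graph_Theory.Graph_Theory" "HOL-Analysis.Analysis"
begin

(* A finite simple graph is a symmetric loop-free digraph without parallel arcs, i.e. an
   instance of the locale pair_graph; an edge uv is represented by the two arcs (u, v) and
   (v, u). *)

definition neighbors :: "'a pair_pre_digraph \<Rightarrow> 'a \<Rightarrow> 'a set" where
  "neighbors G v = {u. (v, u) \<in> parcs G}"

(* On nat, Sup is Max for nonempty finite sets, and Sup {} = 0.  The empty case only concerns
   the graph without vertices and, for the multiplicity, the graphs with at most one vertex. *)

definition max_degree :: "'a pair_pre_digraph \<Rightarrow> nat" where
  "max_degree G = (SUP v\<in>pverts G. card (neighbors G v))"

definition num_common_neighbors :: "'a pair_pre_digraph \<Rightarrow> 'a \<Rightarrow> 'a \<Rightarrow> nat" where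
  "num_common_neighbors G u v = card (neighbors G u \<inter> neighbors G v)"

definition multiplicity_graph :: "'a pair_pre_digraph \<Rightarrow> nat" where
  "multiplicity_graph G =
     Sup {num_common_neighbors G u v | u v. u \<in> pverts G \<and> v \<in> pverts G \<and> u \<noteq> v}"

(* The length of a shortest u-v walk: the library's shortest-walk weight with all arcs of
   weight 1; it is infinity if v is not reachable from u. *)

definition graph_dist :: "'a pair_pre_digraph \<Rightarrow> 'a \<Rightarrow> 'a \<Rightarrow> ereal" where
  "graph_dist G u v = wf_digraph.\<mu> (with_proj G) (\<lambda>_. 1) u v"

definition L_labeling :: "nat \<Rightarrow> nat \<Rightarrow> 'a pair_pre_digraph \<Rightarrow> ('a \<Rightarrow> nat) \<Rightarrow> bool" where
  "L_labeling p q G f \<longleftrightarrow>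
     (\<forall>u\<in>pverts G. \<forall>v\<in>pverts G.
        ((u, v) \<in> parcs G \<longrightarrow> \<bar>int (f u) - int (f v)\<bar> \<ge> int p) \<and>
        (graph_dist G u v = 2 \<longrightarrow> \<bar>int (f u) - int (f v)\<bar> \<ge> int q))"

definition label_span :: "'a pair_pre_digraph \<Rightarrow> ('a \<Rightarrow> nat) \<Rightarrow> nat" where
  "label_span G f = Sup (f ` pverts G) - Inf (f ` pverts G)"

definition L_number :: "nat \<Rightarrow> nat \<Rightarrow> 'a pair_pre_digraph \<Rightarrow> nat" where
  "L_number p q G = (LEAST k. \<exists>f. L_labeling p q G f \<and> label_span G f = k)"

(* In the interval models the interval of v is {l v..r v}; intervals are nonempty, and a
   single point is allowed. *)

definition interval_graph :: "'a pair_pre_digraph \<Rightarrow> bool" where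
  "interval_graph G \<longleftrightarrow>
     (\<exists>l r :: 'a \<Rightarrow> real.
        (\<forall>v\<in>pverts G. l v \<le> r v) \<and>
        (\<forall>u\<in>pverts G. \<forall>v\<in>pverts G. u \<noteq> v \<longrightarrow>
           ((u, v) \<in> parcs G \<longleftrightarrow> {l u..r u} \<inter> {l v..r v} \<noteq> {})))"

definition interval_k_graph :: "nat \<Rightarrow> 'a pair_pre_digraph \<Rightarrow> bool" where
  "interval_k_graph k G \<longleftrightarrow>
     (\<exists>(l :: 'a \<Rightarrow> real) (r :: 'a \<Rightarrow> real) (\<kappa> :: 'a \<Rightarrow> nat).
        (\<forall>v\<in>pverts G. l v \<le> r v \<and> \<kappa> v \<in> {1..k}) \<and>
        (\<forall>u\<in>pverts G. \<forall>v\<in>pverts G.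
           (u, v) \<in> parcs G \<longleftrightarrow> {l u..r u} \<inter> {l v..r v} \<noteq> {} \<and> \<kappa> u \<noteq> \<kappa> v))"

(* The closed arc of the unit circle running counterclockwise from angle a to angle b; it is
   a single point if a = b and the whole circle if b - a \<ge> 2 * pi. *)

definition circle_arc :: "real \<Rightarrow> real \<Rightarrow> complex set" where
  "circle_arc a b = cis ` {a..b}"

definition circular_arc_graph :: "'a pair_pre_digraph \<Rightarrow> bool" where
  "circular_arc_graph G \<longleftrightarrow>
     (\<exists>a b :: 'a \<Rightarrow> real.
        (\<forall>v\<in>pverts G. a v \<le> b v) \<and>
        (\<forall>u\<in>pverts G. \<forall>v\<in>pverts G. u \<noteq> v \<longrightarrow>
           ((u, v) \<in> parcs G \<longleftrightarrow> circle_arc (a u) (b u) \<inter> circle_arc (a v) (b v) \<noteq> {})))"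

definition permutation_graph :: "'a pair_pre_digraph \<Rightarrow> bool" where
  "permutation_graph G \<longleftrightarrow>
     (\<exists>l r :: 'a \<Rightarrow> real.
        (\<forall>v\<in>pverts G. l v \<le> r v) \<and>
        (\<forall>u\<in>pverts G. \<forall>v\<in>pverts G. u \<noteq> v \<longrightarrow>
           ((u, v) \<in> parcs G \<longleftrightarrow>
              {l u..r u} \<subseteq> {l v..r v} \<or> {l v..r v} \<subseteq> {l u..r u})))"

definition graph_complement :: "'a pair_pre_digraph \<Rightarrow> 'a pair_pre_digraph" where
  "graph_complement G =
     \<lparr> pverts = pverts G,
       parcs = {(u, v). u \<in> pverts G \<and> v \<in> pverts G \<and> u \<noteq> v \<and> (u, v) \<notin> parcs G} \<rparr>"

definition cointerval_graph :: "'a pair_pre_digraph \<Rightarrow> bool" where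
  "cointerval_graph G \<longleftrightarrow> interval_graph (graph_complement G)"

end

theory Submission
  imports Defs
begin

text \<open>Write \<open>near v\<close> for the set of vertices at distance 1 or 2 from \<open>v\<close> and \<open>M = max p q\<close>.
  If every nonempty set \<open>S\<close> of vertices contains a vertex \<open>v\<close> with at most \<open>d\<close> elements of \<open>S\<close>
  in \<open>near v\<close>, a greedy labeling by multiples of \<open>M\<close> has span at most \<open>M * d\<close>. In an interval
  model a good candidate for \<open>v\<close> is the vertex of \<open>S\<close> with the leftmost right endpoint: its close
  vertices in \<open>S\<close> are covered by the neighborhoods of one or two vertices reaching furthest.
  This gives \<open>d = \<Delta>\<close> for interval graphs and, if vertices of degree at most 1 are chosen first,
  \<open>d = \<Delta> + \<mu> - 1\<close> for cointerval graphs. For circular-arc graphs, the arcs through a fixed point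
  form a clique, which is labeled on top; the other arcs allow \<open>d = 2 * \<Delta>\<close>.

  For interval k-graphs and permutation graphs one gets \<open>d = 2 * \<Delta> - 2\<close> outside the components
  isomorphic to \<open>K\<^bsub>\<Delta>,\<Delta>\<^esub>\<close>; there a vertex has \<open>\<Delta>\<close> neighbors and \<open>\<Delta> - 1\<close> vertices at distance 2,
  so that choosing any free label already suffices.\<close>

section \<open>Extremal elements of finite sets\<close>

lemma ex_min_on:
  fixes f :: "'a \<Rightarrow> 'b::linorder"
  assumes "finite S" "S \<noteq> {}"
  obtains v where "v \<in> S" "\<And>u. u \<in> S \<Longrightarrow> f v \<le> f u"
  using arg_min_if_finite(1)[OF assms, of f] arg_min_least[OF assms, of _ f] by blast

lemma ex_max_on:
  fixes f :: "'a \<Rightarrow> real"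
  assumes "finite S" "S \<noteq> {}"
  obtains v where "v \<in> S" "\<And>u. u \<in> S \<Longrightarrow> f u \<le> f v"
  using ex_min_on[OF assms, of "\<lambda>x. - f x"] by (metis neg_le_iff_le)

section \<open>Arcs of the unit circle\<close>

lemma cis_shift: "cis (x + 2 * pi * of_int n) = cis x"
  by (simp add: cis_mult[symmetric] cis_multiple_2pi)

lemma cis_eqE:
  assumes "cis x = cis y"
  obtains n :: int where "x = y + 2 * pi * of_int n"
proof -
  have "sin x = sin y \<and> cos x = cos y"
    using assms by (auto simp: complex_eq_iff)
  then show ?thesis using that sin_cos_eq_iff by blast
qed

lemma cis_inj_on_period:
  assumes "cis x = cis y" "0 < x" "x < 2 * pi" "0 < y" "y < 2 * pi"
  shows "x = y"
proof -
  obtain n :: int where n: "x = y + 2 * pi * of_int n" using assms(1) by (rule cis_eqE)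
  have "\<bar>2 * pi * real_of_int n\<bar> < 2 * pi * 1" using n assms(2-5) by linarith
  then have "2 * pi * \<bar>real_of_int n\<bar> < 2 * pi * 1" by (simp add: abs_mult)
  then have "\<bar>real_of_int n\<bar> < 1" using pi_gt_zero by (subst (asm) mult_less_cancel_left_pos) auto
  then have "n = 0" by linarith
  then show ?thesis using n by simp
qed

text \<open>No angle in \<open>{a..b}\<close> is a multiple of \<open>2 * pi\<close>, so subtracting
  the last multiple before \<open>a\<close> puts the interval strictly between 0 and
  \<open>2 * pi\<close>. Cutting the circle at 1 makes such arcs comparable like intervals of the
  line.\<close>

lemma circle_arc_avoiding_one:
  assumes "a \<le> b" "1 \<notin> circle_arc a b"
  obtains l r where "0 < l" "l \<le> r" "r < 2 * pi" "circle_arc a b = cis ` {l..r}"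
proof -
  define n where "n = \<lfloor>a / (2 * pi)\<rfloor>"
  define s where "s = 2 * pi * of_int n"
  have "of_int n \<le> a / (2 * pi)" "a / (2 * pi) < of_int n + 1"
    using floor_correct[of "a / (2 * pi)"] unfolding n_def by auto
  then have s: "s \<le> a" "a < s + 2 * pi"
    unfolding s_def by (simp_all add: field_simps)
  have cis_s: "cis (x + s) = cis x" for x unfolding s_def by (rule cis_shift)
  have one: "cis s = 1" "cis (s + 2 * pi) = 1" using cis_s[of 0] cis_s[of "2 * pi"] by (simp_all add: add.commute)
  have in_arc: "cis x \<in> circle_arc a b" if "a \<le> x" "x \<le> b" for x
    using that unfolding circle_arc_def by simp
  have "s \<noteq> a" using in_arc[of a] one(1) assms by auto
  then have "s < a" using s(1) by simp
  moreover have "b < s + 2 * pi"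
  proof (rule ccontr)
    assume "\<not> b < s + 2 * pi"
    then have "cis (s + 2 * pi) \<in> circle_arc a b" using s(2) by (intro in_arc) auto
    then show False using one(2) assms(2) by simp
  qed
  moreover have "circle_arc a b = cis ` {a - s..b - s}"
  proof -
    have "{a..b} = (\<lambda>x. x + s) ` {a - s..b - s}" by simp
    then show ?thesis unfolding circle_arc_def by (simp only: image_image cis_s)
  qed
  ultimately show ?thesis using that[of "a - s" "b - s"] assms(1) by auto
qed

text \<open>The two points lift to angles \<open>s\<close> and \<open>t\<close> in
  \<open>{a..b}\<close>, with winding numbers \<open>m\<close> and \<open>n\<close>. If
  \<open>m \<le> n\<close>, then \<open>{x..y}\<close> moved by \<open>m\<close> turns lies between
  \<open>s\<close> and \<open>t\<close>; otherwise \<open>{y..x + 2 * pi}\<close> moved by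
  \<open>n\<close> turns lies between \<open>t\<close> and \<open>s\<close>.\<close>

lemma circle_arc_connects:
  assumes "cis x \<in> circle_arc a b" "cis y \<in> circle_arc a b"
  shows "cis ` {x..y} \<subseteq> circle_arc a b \<or> cis ` {y..x + 2 * pi} \<subseteq> circle_arc a b"
proof -
  obtain s t where s: "s \<in> {a..b}" "cis s = cis x" and t: "t \<in> {a..b}" "cis t = cis y"
    using assms unfolding circle_arc_def by auto
  obtain m :: int where m: "s = x + 2 * pi * of_int m" using s(2) by (rule cis_eqE)
  obtain n :: int where n: "t = y + 2 * pi * of_int n" using t(2) by (rule cis_eqE)
  have shift: "cis z \<in> circle_arc a b" if "z + 2 * pi * of_int k \<in> {a..b}" for z and k :: int
    using imageI[OF that, of cis] unfolding circle_arc_def cis_shift .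
  show ?thesis
  proof (cases "m \<le> n")
    case True
    then have le: "2 * pi * real_of_int m \<le> 2 * pi * real_of_int n" by simp
    have "cis z \<in> circle_arc a b" if "z \<in> {x..y}" for z
      using that m n s(1) t(1) le unfolding atLeastAtMost_iff
      by (intro shift[of z m, unfolded atLeastAtMost_iff] conjI; linarith)
    then show ?thesis by blast
  next
    case False
    then have "2 * pi * real_of_int (n + 1) \<le> 2 * pi * real_of_int m"
      by (intro mult_left_mono) auto
    then have le: "2 * pi * real_of_int n + 2 * pi \<le> 2 * pi * real_of_int m"
      by (simp add: algebra_simps)
    have "cis z \<in> circle_arc a b" if "z \<in> {y..x + 2 * pi}" for z
      using that m n s(1) t(1) le unfolding atLeastAtMost_iff
      by (intro shift[of z n, unfolded atLeastAtMost_iff] conjI; linarith)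
    then show ?thesis by blast
  qed
qed

section \<open>Separated labelings of graphs of bounded degree\<close>

locale bounded_degree_graph =
  fixes V :: "'a set" and N :: "'a \<Rightarrow> 'a set" and D :: nat
  assumes finite_V: "finite V"
    and N_subset: "N v \<subseteq> V"
    and N_sym: "u \<in> N v \<Longrightarrow> v \<in> N u"
    and N_irrefl: "v \<notin> N v"
    and degree: "card (N v) \<le> D"
begin

text \<open>The vertices at distance exactly 2.\<close>

definition N2 :: "'a \<Rightarrow> 'a set" where
  "N2 v = {u. u \<noteq> v \<and> u \<notin> N v \<and> N u \<inter> N v \<noteq> {}}"

definition near :: "'a \<Rightarrow> 'a set" where
  "near v = N v \<union> N2 v"

text \<open>The labels are separate arguments, so that a candidate label can be tested before a
  labeling contains it.\<close>

definition separated :: "nat \<Rightarrow> nat \<Rightarrow> 'a \<Rightarrow> 'a \<Rightarrow> nat \<Rightarrow> nat \<Rightarrow> bool" where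
  "separated p q u v a b \<longleftrightarrow>
     (v \<in> N u \<longrightarrow> int p \<le> \<bar>int a - int b\<bar>) \<and> (v \<in> N2 u \<longrightarrow> int q \<le> \<bar>int a - int b\<bar>)"

text \<open>Closeness is measured in the whole graph, not in the subgraph induced by
  \<open>W\<close>; labelings of disjoint parts can thus be glued once the mixed pairs are
  checked.\<close>

definition labels_on :: "'a set \<Rightarrow> nat \<Rightarrow> nat \<Rightarrow> ('a \<Rightarrow> nat) \<Rightarrow> bool" where
  "labels_on W p q f \<longleftrightarrow> (\<forall>u\<in>W. \<forall>v\<in>W. separated p q u v (f u) (f v))"

lemma finite_N: "finite (N v)"
  using N_subset finite_V finite_subset by blast

lemma N2_subset: "N2 v \<subseteq> V"
  unfolding N2_def using N_subset N_sym by fastforce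

lemma near_subset: "near v \<subseteq> V"
  unfolding near_def using N_subset N2_subset by blast

lemma finite_near: "finite (near v)"
  using near_subset finite_V finite_subset by blast

lemma N2_sym: "u \<in> N2 v \<Longrightarrow> v \<in> N2 u"
  unfolding N2_def using N_sym by blast

lemma near_sym: "u \<in> near v \<Longrightarrow> v \<in> near u"
  unfolding near_def using N_sym N2_sym by blast

lemma not_near_self: "v \<notin> near v"
  unfolding near_def N2_def using N_irrefl by blast

lemma N2E:
  assumes "u \<in> N2 v"
  obtains x where "x \<in> N u" "x \<in> N v" "u \<noteq> v" "u \<notin> N v"
  using assms unfolding N2_def by blast

lemma separated_sym: "separated p q u v a b \<Longrightarrow> separated p q v u b a"
  unfolding separated_def using N_sym N2_sym by (simp add: abs_minus_commute)

lemma separated_trivial: "v \<notin> near u \<Longrightarrow> separated p q u v a b"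
  unfolding separated_def near_def by blast

lemma separatedI: "int (max p q) \<le> \<bar>int a - int b\<bar> \<Longrightarrow> separated p q u v a b"
  unfolding separated_def by auto

section \<open>Greedy labelings\<close>

text \<open>Removing the vertices supplied by \<open>step\<close> one by one gives an elimination
  order; labels are assigned in the reverse order.\<close>

lemma greedy_labeling:
  assumes "finite W"
    and step: "\<And>S. S \<subseteq> W \<Longrightarrow> S \<noteq> {} \<Longrightarrow>
      \<exists>v\<in>S. \<forall>f. f ` (S - {v}) \<subseteq> C \<longrightarrow> (\<exists>c\<in>C. \<forall>u\<in>S - {v}. separated p q v u c (f u))"
  shows "\<exists>f. f ` W \<subseteq> C \<and> labels_on W p q f"
proof -
  have "\<exists>f. f ` S \<subseteq> C \<and> labels_on S p q f" if "S \<subseteq> W" for S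
    using finite_subset[OF that \<open>finite W\<close>] that
  proof (induction S rule: finite_psubset_induct)
    case (psubset S)
    show ?case
    proof (cases "S = {}")
      case True
      then show ?thesis by (simp add: labels_on_def)
    next
      case False
      obtain v where v: "v \<in> S" and ext: "\<And>f. f ` (S - {v}) \<subseteq> C \<Longrightarrow>
          \<exists>c\<in>C. \<forall>u\<in>S - {v}. separated p q v u c (f u)"
        using step[OF psubset.prems False] by blast
      obtain f where f: "f ` (S - {v}) \<subseteq> C" "labels_on (S - {v}) p q f"
        using psubset.IH[of "S - {v}"] psubset.prems v by blast
      obtain c where c: "c \<in> C" "\<And>u. u \<in> S - {v} \<Longrightarrow> separated p q v u c (f u)"
        using ext[OF f(1)] by blast
      have "separated p q u w ((f(v := c)) u) ((f(v := c)) w)" if "u \<in> S" "w \<in> S" for u w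
      proof (cases "u = v")
        case True
        then show ?thesis
          using c(2) separated_trivial[OF not_near_self] that by (cases "w = v") auto
      next
        case u: False
        then show ?thesis
          using c(2) separated_sym f(2) that unfolding labels_on_def by (cases "w = v") auto
      qed
      then have "labels_on S p q (f(v := c))" unfolding labels_on_def by blast
      moreover have "(f(v := c)) ` S \<subseteq> C" using f(1) c(1) by auto
      ultimately show ?thesis by blast
    qed
  qed
  then show ?thesis by blast
qed

text \<open>Distinct multiples of \<open>max p q\<close> differ by at least \<open>p\<close> and at
  least \<open>q\<close>, so each labeled close vertex blocks a single multiple. Of the
  \<open>d + 1\<close> multiples up to \<open>max p q * d\<close>, one stays free.\<close>

lemma multiples_labeling:
  assumes "finite W" and "max p q \<ge> 1"
    and sparse: "\<And>S. S \<subseteq> W \<Longrightarrow> S \<noteq> {} \<Longrightarrow> \<exists>v\<in>S. card (S \<inter> near v) \<le> d"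
  shows "\<exists>f. f ` W \<subseteq> {..max p q * d} \<and> labels_on W p q f"
proof -
  define M where "M = max p q"
  define C where "C = (\<lambda>i. M * i) ` {..d}"
  have M: "M \<ge> 1" using assms(2) M_def by simp
  have card_C: "card C = Suc d"
    unfolding C_def using M by (subst card_image) (auto simp: inj_on_def)
  have "\<exists>f. f ` W \<subseteq> C \<and> labels_on W p q f"
  proof (rule greedy_labeling[OF \<open>finite W\<close>])
    fix S assume "S \<subseteq> W" "S \<noteq> {}"
    then obtain v where v: "v \<in> S" "card (S \<inter> near v) \<le> d" using sparse by blast
    have "\<exists>c\<in>C. \<forall>u\<in>S - {v}. separated p q v u c (f u)" if f: "f ` (S - {v}) \<subseteq> C" for f
    proof -
      have fin: "finite (f ` (S \<inter> near v))" using finite_near by blast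
      have "card (f ` (S \<inter> near v)) \<le> card (S \<inter> near v)"
        using finite_near by (intro card_image_le) blast
      then have "\<not> C \<subseteq> f ` (S \<inter> near v)"
        using card_mono[OF fin, of C] v(2) card_C by linarith
      then obtain c where c: "c \<in> C" "c \<notin> f ` (S \<inter> near v)" by blast
      have "separated p q v u c (f u)" if u: "u \<in> S - {v}" for u
      proof (cases "u \<in> near v")
        case True
        then have "f u \<noteq> c" using c u by blast
        moreover obtain i j where ij: "c = M * i" "f u = M * j"
          using c(1) f u unfolding C_def by blast
        ultimately have "i \<noteq> j" by blast
        have "int M * 1 \<le> int M * \<bar>int i - int j\<bar>"
          using \<open>i \<noteq> j\<close> by (intro mult_left_mono) auto
        also have "\<dots> = \<bar>int c - int (f u)\<bar>"
          unfolding ij by (simp add: abs_mult flip: right_diff_distrib)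
        finally show ?thesis by (intro separatedI) (simp add: M_def)
      next
        case False
        then show ?thesis by (rule separated_trivial)
      qed
      then show ?thesis using c(1) by blast
    qed
    then show "\<exists>v\<in>S. \<forall>f. f ` (S - {v}) \<subseteq> C \<longrightarrow>
        (\<exists>c\<in>C. \<forall>u\<in>S - {v}. separated p q v u c (f u))" using v(1) by blast
  qed
  moreover have "C \<subseteq> {..max p q * d}" unfolding C_def M_def by auto
  ultimately show ?thesis by (meson order_trans)
qed

text \<open>A labeled neighbor blocks at most \<open>2 * p - 1\<close> labels and a vertex at
  distance 2 at most \<open>2 * q - 1\<close>. Since 0 is a label too, there is one label more than
  can be blocked, whatever the order of the vertices.\<close>

lemma first_fit_labeling:
  assumes "finite W" and "p \<ge> 1" "q \<ge> 1"
    and a: "\<And>v. v \<in> W \<Longrightarrow> card (N v) \<le> a" and b: "\<And>v. v \<in> W \<Longrightarrow> card (N2 v) \<le> b"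
  shows "\<exists>f. f ` W \<subseteq> {..(2 * p - 1) * a + (2 * q - 1) * b} \<and> labels_on W p q f"
proof (rule greedy_labeling[OF \<open>finite W\<close>])
  fix S assume S: "S \<subseteq> W" "S \<noteq> {}"
  then obtain v where v: "v \<in> S" by blast
  define L where "L = (2 * p - 1) * a + (2 * q - 1) * b"
  have "\<exists>c\<in>{..L}. \<forall>u\<in>S - {v}. separated p q v u c (f u)" for f :: "'a \<Rightarrow> nat"
  proof -
    \<comment> \<open>The labels closer than \<open>k\<close> to \<open>f u\<close>. Truncated
      subtraction cuts this window off at 0, which only makes it smaller.\<close>
    define I where "I = (\<lambda>u k. {f u + 1 - k..<f u + k})"
    define F where "F = (\<Union>u\<in>N v. I u p) \<union> (\<Union>u\<in>N2 v. I u q)"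
    have finN2: "finite (N2 v)" using N2_subset finite_V finite_subset by blast
    have I: "card (I u k) \<le> 2 * k - 1" for u k unfolding I_def by auto
    have card_U: "card (\<Union>u\<in>A. I u k) \<le> (2 * k - 1) * n" if "finite A" "card A \<le> n" for A k n
    proof -
      have "card (\<Union>u\<in>A. I u k) \<le> (\<Sum>u\<in>A. card (I u k))" by (rule card_UN_le[OF that(1)])
      also have "\<dots> \<le> (\<Sum>u\<in>A. 2 * k - 1)" by (intro sum_mono I)
      also have "\<dots> \<le> (2 * k - 1) * n" using that(2) by (simp add: mult.commute)
      finally show ?thesis .
    qed
    have "card F \<le> card (\<Union>u\<in>N v. I u p) + card (\<Union>u\<in>N2 v. I u q)"
      unfolding F_def by (rule card_Un_le)
    also have "\<dots> \<le> L" unfolding L_def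
      using v S by (intro add_mono card_U finite_N finN2 a b) auto
    also have "\<dots> < card {..L}" by simp
    finally have lt: "card F < card {..L}" .
    have "finite F" unfolding F_def I_def using finite_N finN2 by auto
    then have "\<not> {..L} \<subseteq> F" using lt card_mono[of F "{..L}"] by linarith
    then obtain c where c: "c \<in> {..L}" "c \<notin> F" by blast
    have "separated p q v u c (f u)" for u
      unfolding separated_def using c(2) unfolding F_def I_def by fastforce
    then show ?thesis using c(1) by blast
  qed
  then show "\<exists>v\<in>S. \<forall>f. f ` (S - {v}) \<subseteq> {..(2 * p - 1) * a + (2 * q - 1) * b} \<longrightarrow>
      (\<exists>c\<in>{..(2 * p - 1) * a + (2 * q - 1) * b}. \<forall>u\<in>S - {v}. separated p q v u c (f u))"
    using v unfolding L_def by blast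
qed

section \<open>Biclique components\<close>

text \<open>For \<open>D \<ge> 1\<close>, the union of the components that are complete bipartite
  with both sides of size \<open>D\<close>: prescribing the exact neighborhoods closes
  \<open>A \<union> B\<close> under adjacency. Placing \<open>v\<close> in \<open>A\<close> is no
  restriction, because the sides can be swapped.\<close>

definition biclique_part :: "'a set" where
  "biclique_part = {v. \<exists>A B. card A = D \<and> card B = D \<and> v \<in> A \<and>
     (\<forall>a\<in>A. N a = B) \<and> (\<forall>b\<in>B. N b = A)}"

lemma biclique_part_N: "v \<in> biclique_part \<Longrightarrow> u \<in> N v \<Longrightarrow> u \<in> biclique_part"
  unfolding biclique_part_def by blast

lemma biclique_part_near:
  assumes "v \<in> biclique_part" "u \<in> near v"
  shows "u \<in> biclique_part"
proof (cases "u \<in> N v")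
  case True
  then show ?thesis using assms(1) biclique_part_N by blast
next
  case False
  then obtain x where "x \<in> N u" "x \<in> N v" using assms(2) unfolding near_def N2_def by blast
  then show ?thesis using biclique_part_N[OF assms(1)] biclique_part_N N_sym by blast
qed

text \<open>Two steps from \<open>v\<close> lead back to its own side, which has
  \<open>D - 1\<close> other vertices.\<close>

lemma biclique_part_card_N2:
  assumes "v \<in> biclique_part" "D \<ge> 1"
  shows "card (N2 v) \<le> D - 1"
proof -
  obtain A B where AB: "card A = D" "v \<in> A" "\<And>a. a \<in> A \<Longrightarrow> N a = B" "\<And>b. b \<in> B \<Longrightarrow> N b = A"
    using assms(1) unfolding biclique_part_def by blast
  have "N2 v \<subseteq> A - {v}"
  proof
    fix w assume "w \<in> N2 v"
    then obtain x where x: "x \<in> N w" "x \<in> N v" "w \<noteq> v" by (rule N2E)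
    then have "N x = A" using AB(2-4) by blast
    then show "w \<in> A - {v}" using x(1,3) N_sym by blast
  qed
  moreover have "finite A"
    using AB(1) assms(2) by (intro card_ge_0_finite) simp
  ultimately have "card (N2 v) \<le> card (A - {v})" by (intro card_mono) auto
  then show ?thesis using AB(1,2) \<open>finite A\<close> by simp
qed

text \<open>No close pair joins a biclique component to the rest, so both parts may use the same
  range of labels: first fit on the components, multiples of \<open>max p q\<close>
  elsewhere.\<close>

lemma biclique_labeling:
  assumes "p \<ge> 1" "q \<ge> 1" "D \<ge> 1"
    and sparse: "\<And>S. S \<subseteq> V \<Longrightarrow> S \<noteq> {} \<Longrightarrow>
      \<exists>x\<in>S. card (S \<inter> near x) \<le> 2 * D - 2 \<or> x \<in> biclique_part"
  shows "\<exists>f. f ` V \<subseteq> {..(2 * p - 1) * D + (2 * q - 1) * (D - 1)} \<and> labels_on V p q f"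
proof -
  define Z where "Z = V \<inter> biclique_part"
  define L where "L = (2 * p - 1) * D + (2 * q - 1) * (D - 1)"
  \<comment> \<open>Replacing the factor \<open>D\<close> in \<open>L\<close> by
    \<open>D - 1\<close> leaves \<open>(p + q - 1) * (2 * D - 2)\<close>, and
    \<open>p + q - 1\<close> is at least \<open>max p q\<close>.\<close>
  have "max p q * (2 * D - 2) \<le> L"
  proof -
    obtain D' where D': "D = Suc D'" using assms(3) by (cases D) auto
    obtain p' where p': "p = Suc p'" using assms(1) by (cases p) auto
    obtain q' where q': "q = Suc q'" using assms(2) by (cases q) auto
    show ?thesis unfolding L_def D' p' q' by (auto simp: max_def algebra_simps)
  qed
  moreover obtain f where f: "f ` (V - Z) \<subseteq> {..max p q * (2 * D - 2)}" "labels_on (V - Z) p q f"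
  proof (rule exE[OF multiples_labeling[of "V - Z" p q "2 * D - 2"]])
    show "finite (V - Z)" using finite_V by blast
    show "1 \<le> max p q" using assms by simp
    show "\<exists>v\<in>S. card (S \<inter> near v) \<le> 2 * D - 2" if "S \<subseteq> V - Z" "S \<noteq> {}" for S
      using sparse[of S] that unfolding Z_def by blast
  qed blast
  ultimately have f': "f ` (V - Z) \<subseteq> {..L}" by fastforce
  obtain g where g: "g ` Z \<subseteq> {..L}" "labels_on Z p q g"
    unfolding L_def
    using first_fit_labeling[of Z p q D "D - 1"] finite_V assms degree biclique_part_card_N2
    unfolding Z_def by blast
  define h where "h v = (if v \<in> Z then g v else f v)" for v
  have "separated p q u v (h u) (h v)" if uv: "u \<in> V" "v \<in> V" for u v
  proof (cases "u \<in> Z \<longleftrightarrow> v \<in> Z")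
    case True
    then show ?thesis using f(2) g(2) uv unfolding labels_on_def h_def by auto
  next
    case False
    then have "v \<notin> near u"
      using biclique_part_near near_sym uv unfolding Z_def by blast
    then show ?thesis by (rule separated_trivial)
  qed
  then have "labels_on V p q h" unfolding labels_on_def by blast
  moreover have "h ` V \<subseteq> {..L}" using f' g(1) unfolding h_def by auto
  ultimately show ?thesis unfolding L_def by blast
qed

section \<open>Counting close vertices\<close>

text \<open>A closed neighborhood has at most \<open>D + 1\<close> elements, and one of them is
  \<open>v\<close>, which is not close to itself.\<close>

lemma card_closed_neighborhood_minus:
  assumes "v \<in> N x" "A \<subseteq> insert x (N x) - {v}"
  shows "card A \<le> D"
proof -
  have "card A \<le> card (insert x (N x) - {v})"
    using assms(2) finite_N by (intro card_mono) auto
  also have "\<dots> \<le> D" using assms(1) N_irrefl finite_N degree[of x] by simp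
  finally show ?thesis .
qed

text \<open>Each of the two neighborhoods contains \<open>v\<close> and so contributes at most
  \<open>D - 1\<close> close vertices. The case \<open>x = y\<close> is allowed.\<close>

lemma sparse_if_covered:
  assumes "v \<in> N x" "v \<in> N y" "S \<inter> near v \<subseteq> N x \<union> N y"
  shows "card (S \<inter> near v) \<le> 2 * D - 2"
proof -
  have "card (S \<inter> near v) \<le> card ((N x - {v}) \<union> (N y - {v}))"
    using assms(3) not_near_self finite_N by (intro card_mono) auto
  also have "\<dots> \<le> card (N x - {v}) + card (N y - {v})" by (rule card_Un_le)
  also have "\<dots> \<le> 2 * D - 2"
    using assms(1,2) finite_N degree[of x] degree[of y] by simp
  finally show ?thesis .
qed

text \<open>The case where the greedy bound at \<open>v\<close> is one too large. Then \<open>N v\<close> and \<open>N x1\<close> have the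
  full size \<open>D\<close>, and the vertex of \<open>N v\<close> with the fewest neighbors in \<open>N x1\<close> can be removed
  instead of \<open>v\<close>, unless \<open>N v \<union> N x1\<close> is a biclique component.\<close>

lemma sparse_or_biclique:
  assumes "S \<subseteq> V" "v \<in> S" "x1 \<in> N v" and N2_sub: "S \<inter> N2 v \<subseteq> N x1"
    and chain: "\<And>x y. \<lbrakk>N v \<subseteq> S; N x1 \<subseteq> S; N v \<inter> N x1 = {}; card (N v) = D; x \<in> N v;
      y \<in> N v\<rbrakk> \<Longrightarrow>
      N x \<inter> N x1 \<subseteq> N y \<or> N y \<inter> N x1 \<subseteq> N x"
    and outside: "\<And>x z. \<lbrakk>N v \<subseteq> S; N x1 \<subseteq> S; N v \<inter> N x1 = {}; card (N v) = D; x \<in> N v;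
      z \<in> N x; z \<notin> N v; z \<notin> N x1\<rbrakk> \<Longrightarrow> z \<notin> S \<and> N z \<inter> S \<subseteq> N v"
  shows "\<exists>x\<in>S. card (S \<inter> near x) \<le> 2 * D - 2 \<or> x \<in> biclique_part"
proof (cases "card (S \<inter> near v) \<le> 2 * D - 2")
  case True
  then show ?thesis using \<open>v \<in> S\<close> by blast
next
  case False
  define A where "A = N x1"
  define B where "B = N v"
  have vA: "v \<in> A" using \<open>x1 \<in> N v\<close> N_sym A_def by blast
  have finA: "finite A" and finB: "finite B" unfolding A_def B_def by (rule finite_N)+
  have cA: "card A \<le> D" and cB: "card B \<le> D" unfolding A_def B_def by (rule degree)+
  have "card A \<ge> 1" using vA finA by (metis One_nat_def Suc_leI card_gt_0_iff empty_iff)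
  then have D: "D \<ge> 1" using cA by linarith
  have N2A: "S \<inter> N2 v \<subseteq> A - {v}" using N2_sub unfolding A_def N2_def by blast
  have c1: "card (S \<inter> B) \<le> card B" by (intro card_mono finB) blast
  have c2: "card (S \<inter> N2 v) \<le> card (A - {v})" using N2A finA by (intro card_mono) auto
  have c3: "card (A - {v}) = card A - 1" using vA finA by simp
  have "S \<inter> near v = (S \<inter> B) \<union> (S \<inter> N2 v)" unfolding near_def B_def by blast
  then have "card (S \<inter> near v) \<le> card (S \<inter> B) + card (S \<inter> N2 v)" by (simp add: card_Un_le)
  \<comment> \<open>At most \<open>D\<close> close vertices come from \<open>B\<close> and at most
    \<open>D - 1\<close> from \<open>A - {v}\<close>. Exceeding \<open>2 * D - 2\<close> turns all
    these estimates into equalities.\<close>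
  then have cards: "card (S \<inter> B) = D" "card B = D" "card (S \<inter> N2 v) = card (A - {v})" "card A = D"
    using False c1 c2 c3 cA cB D \<open>card A \<ge> 1\<close> by linarith+
  have BS: "B \<subseteq> S" using card_subset_eq[OF finB, of "S \<inter> B"] cards by auto
  have N2_eq: "S \<inter> N2 v = A - {v}"
    using card_subset_eq[OF _ N2A] cards finA by blast
  then have AS: "A \<subseteq> S" using \<open>v \<in> S\<close> by blast
  have disj: "A \<inter> B = {}"
    using N2_eq N_irrefl[of v] unfolding N2_def B_def by blast
  have disj': "N v \<inter> N x1 = {}" using disj unfolding A_def B_def by blast
  note BS' = BS[unfolded B_def] and AS' = AS[unfolded A_def] and cB' = cards(2)[unfolded B_def]
  have chain': "N x \<inter> A \<subseteq> N y \<or> N y \<inter> A \<subseteq> N x" if "x \<in> B" "y \<in> B" for x y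
    using chain[OF BS' AS' disj' cB'] that unfolding A_def B_def by blast
  have out: "z \<notin> S" "N z \<inter> S \<subseteq> B" if "x \<in> B" "z \<in> N x" "z \<notin> B" "z \<notin> A" for x z
    using outside[OF BS' AS' disj' cB'] that unfolding A_def B_def by blast+
  have "B \<noteq> {}" using \<open>x1 \<in> N v\<close> B_def by blast
  \<comment> \<open>By \<open>chain'\<close> the sets \<open>N y \<inter> A\<close> with
    \<open>y\<close> in \<open>B\<close> are nested, so one of least size lies in all the
    others.\<close>
  obtain x where x: "x \<in> B" and x_min: "\<And>y. y \<in> B \<Longrightarrow> card (N x \<inter> A) \<le> card (N y \<inter> A)"
    using ex_min_on[OF finB \<open>B \<noteq> {}\<close>, of "\<lambda>y. card (N y \<inter> A)"] by blast
  have least: "N x \<inter> A \<subseteq> N y" if "y \<in> B" for y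
  proof (rule ccontr)
    assume *: "\<not> N x \<inter> A \<subseteq> N y"
    then have "N y \<inter> A \<subset> N x \<inter> A" using chain'[OF x that] by blast
    then have "card (N y \<inter> A) < card (N x \<inter> A)" using finA by (intro psubset_card_mono) auto
    then show False using x_min[OF that] by simp
  qed
  \<comment> \<open>Such a \<open>w\<close> is adjacent to all \<open>D\<close> vertices of
    \<open>B\<close>, which exhausts its degree.\<close>
  have NB: "N w = B" if w: "w \<in> N x \<inter> A" for w
  proof -
    have "B \<subseteq> N w" using least w N_sym by blast
    then show ?thesis using card_seteq[OF finite_N, of B w] degree[of w] cards(2) by simp
  qed
  have near_x: "S \<inter> near x \<subseteq> (A \<union> B) - {x}"
  proof
    fix w assume w: "w \<in> S \<inter> near x"
    have "w \<in> A \<union> B"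
    proof (cases "w \<in> N x")
      case True
      then show ?thesis using out[OF x] w by blast
    next
      case False
      then obtain z where z: "z \<in> N w" "z \<in> N x" using w unfolding near_def N2_def by blast
      have wz: "w \<in> N z" using z N_sym by blast
      consider "z \<in> A" | "z \<in> B" | "z \<notin> A" "z \<notin> B" by blast
      then show ?thesis
      proof cases
        case 1
        then show ?thesis using NB z wz by blast
      next
        case 2
        then show ?thesis using out[OF 2 wz] w by blast
      next
        case 3
        then show ?thesis using out(2)[OF x z(2)] w wz by blast
      qed
    qed
    then show "w \<in> A \<union> B - {x}" using w not_near_self by blast
  qed
  have xS: "x \<in> S" using x BS by blast
  have cAB: "card (A \<union> B - {x}) = 2 * D - 1"
    using x finA finB disj cards by (simp add: card_Un_disjoint)
  \<comment> \<open>By \<open>near_x\<close> the vertex \<open>x\<close> has at most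
    \<open>2 * D - 1\<close> close vertices in \<open>S\<close>; if one candidate is missing,
    \<open>x\<close> is sparse. Otherwise the biclique emerges.\<close>
  show ?thesis
  proof (cases "S \<inter> near x = A \<union> B - {x}")
    case False
    then have "card (S \<inter> near x) < card (A \<union> B - {x})"
      using near_x finA finB by (intro psubset_card_mono) auto
    then show ?thesis using cAB xS by force
  next
    case full: True
    \<comment> \<open>A vertex of \<open>A\<close> not adjacent to \<open>x\<close> is close to
      \<open>x\<close>, and the connecting vertex must lie in \<open>B\<close>. By the chain
      property, a neighbor of \<open>x\<close> in \<open>B\<close> with most neighbors in
      \<open>A\<close> is adjacent to all of \<open>A\<close> and to \<open>x\<close>, which makes
      \<open>D + 1\<close> neighbors.\<close>
    have A_Nx: "A \<subseteq> N x"
    proof (rule ccontr)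
      assume not: "\<not> A \<subseteq> N x"
      have "z \<in> B" if w: "w \<in> A" "w \<notin> N x" "z \<in> N w" "z \<in> N x" for w z
      proof (rule ccontr)
        assume zB: "z \<notin> B"
        have wB: "w \<notin> B" using w disj by blast
        show False
        proof (cases "z \<in> A")
          case True
          then show False using NB w wB N_sym by blast
        next
          case False
          then show False using out(2)[OF x w(4) zB] wB w AS N_sym by blast
        qed
      qed
      moreover have "\<exists>z. z \<in> N w \<and> z \<in> N x" if "w \<in> A" "w \<notin> N x" for w
      proof -
        have "w \<in> near x" using full that disj x by blast
        then show ?thesis using that unfolding near_def N2_def by blast
      qed
      ultimately have conn: "\<exists>z\<in>B. z \<in> N w \<and> z \<in> N x" if "w \<in> A" "w \<notin> N x" for w
        using that by blast
      obtain w0 where "w0 \<in> A" "w0 \<notin> N x" using not by blast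
      define Bx where "Bx = {z \<in> B. z \<in> N x}"
      have "Bx \<noteq> {}" "finite Bx" using conn \<open>w0 \<in> A\<close> \<open>w0 \<notin> N x\<close> finB unfolding Bx_def by auto
      then obtain z where z: "z \<in> Bx" and z_max: "\<And>y. y \<in> Bx \<Longrightarrow> card (N y \<inter> A) \<le> card (N z \<inter> A)"
        using ex_max_on[of Bx "\<lambda>y. real (card (N y \<inter> A))"] by (metis of_nat_le_iff)
      have "A \<subseteq> N z"
      proof
        fix w assume w: "w \<in> A"
        show "w \<in> N z"
        proof (cases "w \<in> N x")
          case True
          then show ?thesis using least[of z] z w unfolding Bx_def by blast
        next
          case False
          then obtain y where y: "y \<in> Bx" "w \<in> N y" using conn w N_sym unfolding Bx_def by blast
          show ?thesis
          proof (rule ccontr)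
            assume "w \<notin> N z"
            then have "N z \<inter> A \<subset> N y \<inter> A"
              using chain'[of y z] y z w unfolding Bx_def by blast
            then have "card (N z \<inter> A) < card (N y \<inter> A)"
              using finA by (intro psubset_card_mono) auto
            then show False using z_max[OF y(1)] by simp
          qed
        qed
      qed
      then have "insert x A \<subseteq> N z" using z N_sym unfolding Bx_def by blast
      then have "card (insert x A) \<le> D" using card_mono[OF finite_N] degree le_trans by blast
      moreover have "x \<notin> A" using x disj by blast
      ultimately show False using finA cards by simp
    qed
    have "N b = A" if "b \<in> B" for b
    proof -
      have "A \<subseteq> N b" using least[OF that] A_Nx by blast
      then show ?thesis using card_seteq[OF finite_N, of A b] degree[of b] cards(4) by simp
    qed
    moreover have "N a = B" if "a \<in> A" for a using NB A_Nx that by blast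
    ultimately have "v \<in> biclique_part" using vA cards unfolding biclique_part_def by blast
    then show ?thesis using \<open>v \<in> S\<close> by blast
  qed
qed

section \<open>Interval k-graphs\<close>

text \<open>The vertex \<open>v\<close> of \<open>S\<close> with leftmost right endpoint is
  examined. If two colors occur among its neighbors through \<open>r v\<close>, every close vertex
  differs in color from one of two far-reaching neighbors. If only one color occurs, intervals nest
  well enough for \<open>sparse_or_biclique\<close>.\<close>

lemma interval_k_sparse:
  fixes l r :: "'a \<Rightarrow> real" and \<kappa> :: "'a \<Rightarrow> nat"
  assumes lr: "\<And>v. v \<in> V \<Longrightarrow> l v \<le> r v"
    and adj: "\<And>u v. u \<in> V \<Longrightarrow> v \<in> V \<Longrightarrow> u \<in> N v \<longleftrightarrow> l u \<le> r v \<and> l v \<le> r u \<and> \<kappa> u \<noteq> \<kappa> v"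
    and S: "S \<subseteq> V" "S \<noteq> {}"
  shows "\<exists>x\<in>S. card (S \<inter> near x) \<le> 2 * D - 2 \<or> x \<in> biclique_part"
proof -
  have "finite S" using S(1) finite_V finite_subset by blast
  then obtain v where v: "v \<in> S" and v_min: "\<And>u. u \<in> S \<Longrightarrow> r v \<le> r u"
    using ex_min_on[OF _ S(2), of r] by blast
  have vV: "v \<in> V" using v S by blast
  have lv: "l v \<le> r v" using lr vV by blast
  have NV: "x \<in> V" if "x \<in> N u" for x u using that N_subset by blast
  have adjN: "l u \<le> r w \<and> l w \<le> r u \<and> \<kappa> u \<noteq> \<kappa> w" if "u \<in> N w" for u w
    using that adj NV N_sym by blast
  \<comment> \<open>The neighbors of \<open>v\<close> whose interval contains the point
    \<open>r v\<close>. By the choice of \<open>v\<close>, all its neighbors in \<open>S\<close>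
    belong to \<open>C\<close>.\<close>
  define C where "C = {x \<in> N v. r v \<le> r x}"
  have finC: "finite C" unfolding C_def using finite_N by simp
  have C_lv: "l x \<le> r v" "r v \<le> r x" "\<kappa> x \<noteq> \<kappa> v" "x \<in> V" if "x \<in> C" for x
    using that adjN[of x v] NV unfolding C_def by auto
  have Nv_C: "x \<in> C" if "x \<in> N v" "x \<in> S" for x using that v_min unfolding C_def by blast
  text \<open>A common neighbor ending before \<open>r v\<close> only leads to vertices around \<open>r v\<close>.\<close>
  have N2_color: "\<kappa> w = \<kappa> v \<and> l w \<le> r z" if "w \<in> S" "w \<in> N2 v" "z \<in> N w" "z \<in> N v" "r z < r v" for w z
  proof -
    have "w \<notin> N v" using that unfolding N2_def by blast
    moreover have "w \<in> V" using that S by blast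
    ultimately show ?thesis
      using adj[of w v] vV adjN[OF that(3)] v_min[OF that(1)] that(5) lv by force
  qed
  show ?thesis
  proof (cases "C = {}")
    case True
    \<comment> \<open>All close vertices in \<open>S\<close> are now at distance 2, have the color
      of \<open>v\<close>, and are adjacent to the single neighbor of \<open>v\<close> reaching
      furthest right.\<close>
    show ?thesis
    proof (cases "N v = {}")
      case True
      then have "near v = {}" unfolding near_def N2_def by blast
      then show ?thesis using v by (intro bexI[of _ v]) auto
    next
      case False
      then obtain x where x: "x \<in> N v" and x_max: "\<And>u. u \<in> N v \<Longrightarrow> r u \<le> r x"
        using ex_max_on[OF finite_N, of v r] by blast
      have rx: "r x < r v" using x \<open>C = {}\<close> unfolding C_def by force
      have "w \<in> N x" if w: "w \<in> S" "w \<in> near v" for w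
      proof -
        have "w \<notin> N v" using w Nv_C \<open>C = {}\<close> by blast
        then have w2: "w \<in> N2 v" using w unfolding near_def by blast
        then obtain z where z: "z \<in> N w" "z \<in> N v" by (rule N2E)
        have "r z < r v" using z \<open>C = {}\<close> unfolding C_def by force
        then have "\<kappa> w = \<kappa> v" "l w \<le> r z" using N2_color[OF w(1) w2 z] by auto
        then show ?thesis
          using adj[of w x] adjN[OF x] x_max[OF z(2)] v_min[OF w(1)] rx w(1) S NV[OF x] lr[OF NV[OF x]]
          by force
      qed
      then have "S \<inter> near v \<subseteq> N x \<union> N x" by blast
      then show ?thesis using sparse_if_covered[of v x x S] N_sym[OF x] v by blast
    qed
  next
    case False
    then obtain x1 where x1: "x1 \<in> C" and x1_max: "\<And>u. u \<in> C \<Longrightarrow> r u \<le> r x1"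
      using ex_max_on[OF finC, of r] by blast
    have x1N: "x1 \<in> N v" using x1 unfolding C_def by blast
    have reach: "w \<in> N x" if "x \<in> C" "w \<in> V" "r v \<le> r w" "l w \<le> r x" "\<kappa> w \<noteq> \<kappa> x" for w x
      using adj[of w x] that C_lv[OF that(1)] by auto
    \<comment> \<open>If the common neighbor ends before \<open>r v\<close>, then \<open>w\<close>
      has the color of \<open>v\<close>, and \<open>x1\<close> can replace that neighbor.\<close>
    have N2_C: "\<exists>z\<in>C. l w \<le> r z \<and> \<kappa> w \<noteq> \<kappa> z" if w: "w \<in> S" "w \<in> N2 v" for w
    proof -
      obtain z where z: "z \<in> N w" "z \<in> N v" using w(2) by (rule N2E)
      show ?thesis
      proof (cases "r v \<le> r z")
        case True
        then show ?thesis using z adjN[OF z(1)] unfolding C_def by force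
      next
        case False
        then have "\<kappa> w = \<kappa> v" "l w \<le> r z" using N2_color[OF w z] by auto
        then have "l w \<le> r x1" "\<kappa> w \<noteq> \<kappa> x1" using False C_lv(2,3)[OF x1] by auto
        then show ?thesis using x1 by blast
      qed
    qed
    show ?thesis
    proof (cases "\<forall>x\<in>C. \<kappa> x = \<kappa> x1")
      case False
      \<comment> \<open>A vertex colored unlike \<open>x1\<close> is served by \<open>x1\<close>.
        One colored like \<open>x1\<close> can only be reached through members of \<open>C\<close>
        of another color, among which \<open>x2\<close> reaches furthest.\<close>
      define C2 where "C2 = {x \<in> C. \<kappa> x \<noteq> \<kappa> x1}"
      have "C2 \<noteq> {}" "finite C2" using False finC unfolding C2_def by auto
      then obtain x2 where x2: "x2 \<in> C2" and x2_max: "\<And>u. u \<in> C2 \<Longrightarrow> r u \<le> r x2"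
        using ex_max_on[of C2 r] by blast
      have x2C: "x2 \<in> C" "\<kappa> x2 \<noteq> \<kappa> x1" using x2 unfolding C2_def by auto
      have "w \<in> N x1 \<union> N x2" if w: "w \<in> S" "w \<in> near v" for w
      proof -
        have wV: "w \<in> V" and rw: "r v \<le> r w" using w S v_min by auto
        show ?thesis
        proof (cases "w \<in> N v")
          case True
          then have "l w \<le> r v" using adjN by blast
          then show ?thesis
            using reach[OF x1 wV rw] reach[OF x2C(1) wV rw] C_lv(2)[OF x1] C_lv(2)[OF x2C(1)] x2C(2)
            by force
        next
          case False
          then obtain z where z: "z \<in> C" "l w \<le> r z" "\<kappa> w \<noteq> \<kappa> z"
            using N2_C w unfolding near_def by blast
          show ?thesis
          proof (cases "\<kappa> w = \<kappa> x1")
            case True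
            then have "r z \<le> r x2" using x2_max z unfolding C2_def by simp
            then show ?thesis using reach[OF x2C(1) wV rw] z(2) x2C(2) True by force
          next
            case False
            then show ?thesis using reach[OF x1 wV rw] z(2) x1_max[OF z(1)] by force
          qed
        qed
      qed
      then have "S \<inter> near v \<subseteq> N x1 \<union> N x2" by blast
      moreover have "v \<in> N x1" "v \<in> N x2" using x1 x2C N_sym unfolding C_def by blast+
      ultimately show ?thesis using sparse_if_covered v by blast
    next
      case mono: True
      show ?thesis
      proof (rule sparse_or_biclique[OF S(1) v x1N])
        show "S \<inter> N2 v \<subseteq> N x1"
        proof
          fix w assume w: "w \<in> S \<inter> N2 v"
          then obtain z where z: "z \<in> C" "l w \<le> r z" "\<kappa> w \<noteq> \<kappa> z" using N2_C by blast
          then show "w \<in> N x1"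
            using reach[OF x1, of w] x1_max[OF z(1)] mono w S v_min by force
        qed
      next
        fix x y assume sub: "N v \<subseteq> S" "N x1 \<subseteq> S" and xy: "x \<in> N v" "y \<in> N v"
        \<comment> \<open>All of \<open>C\<close> has one color, so a vertex of \<open>S\<close>
          adjacent to one member of \<open>C\<close> is adjacent to every member reaching at least
          as far.\<close>
        have *: "N x \<inter> N x1 \<subseteq> N y" if "x \<in> N v" "y \<in> N v" "r x \<le> r y" for x y
        proof
          fix w assume w: "w \<in> N x \<inter> N x1"
          have "x \<in> C" "y \<in> C" using that sub Nv_C by blast+
          then show "w \<in> N y"
            using reach[of y w] adjN[of w x] w that(3) mono sub S v_min[of w] by force
        qed
        show "N x \<inter> N x1 \<subseteq> N y \<or> N y \<inter> N x1 \<subseteq> N x"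
          using *[OF xy] *[OF xy(2,1)] by linarith
      next
        fix x z assume sub: "N v \<subseteq> S" "N x1 \<subseteq> S" and cD: "card (N v) = D" and x: "x \<in> N v"
          and z: "z \<in> N x" "z \<notin> N v" "z \<notin> N x1"
        have xC: "x \<in> C" using x sub Nv_C by blast
        have zV: "z \<in> V" using z(1) NV by blast
        have rz: "r z < r v"
        proof (rule ccontr)
          assume "\<not> r z < r v"
          then show False
            using reach[OF x1 zV] adjN[OF z(1)] x1_max[OF xC] mono xC z(3) by force
        qed
        \<comment> \<open>A counterexample \<open>w\<close> has the color of \<open>v\<close> and
          covers everything from \<open>r z\<close> to \<open>r v\<close>, so it is adjacent to all
          of \<open>N v\<close>. As \<open>N v\<close> has size \<open>D\<close>, this gives
          \<open>N w = N v\<close>, although \<open>z\<close> lies only in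
          \<open>N w\<close>.\<close>
        have "w \<in> N v" if w: "w \<in> N z" "w \<in> S" for w
        proof (rule ccontr)
          assume not: "w \<notin> N v"
          have wV: "w \<in> V" and rw: "r v \<le> r w" using w S v_min by auto
          have lw: "l w \<le> r z" using adjN[OF w(1)] by blast
          then have \<kappa>w: "\<kappa> w = \<kappa> v" using not adj[OF wV vV] rw rz lv by force
          have "N v \<subseteq> N w"
          proof
            fix u assume u: "u \<in> N v"
            then have uC: "u \<in> C" using sub Nv_C by blast
            have "w \<in> N u" using reach[OF uC wV rw] lw rz C_lv[OF uC] \<kappa>w by force
            then show "u \<in> N w" by (rule N_sym)
          qed
          then have "N v = N w" using card_seteq[OF finite_N] degree[of w] cD by simp
          then show False using z(2) w(1) N_sym by blast
        qed
        then show "z \<notin> S \<and> N z \<inter> S \<subseteq> N v" using rz v_min by force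
      qed
    qed
  qed
qed

section \<open>Permutation graphs\<close>

lemma permutation_sparse:
  fixes l r :: "'a \<Rightarrow> real"
  assumes adj: "\<And>u v. u \<in> V \<Longrightarrow> v \<in> V \<Longrightarrow> u \<noteq> v \<Longrightarrow>
      u \<in> N v \<longleftrightarrow> (l v \<le> l u \<and> r u \<le> r v) \<or> (l u \<le> l v \<and> r v \<le> r u)"
    and S: "S \<subseteq> V" "S \<noteq> {}"
  shows "\<exists>x\<in>S. card (S \<inter> near x) \<le> 2 * D - 2 \<or> x \<in> biclique_part"
proof -
  have finS: "finite S" using S(1) finite_V finite_subset by blast
  then obtain v0 where v0: "v0 \<in> S" and v0_min: "\<And>u. u \<in> S \<Longrightarrow> r v0 \<le> r u"
    using ex_min_on[OF _ S(2), of r] by blast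
  define S0 where "S0 = {u \<in> S. r u = r v0}"
  have "S0 \<noteq> {}" "finite S0" using v0 finS unfolding S0_def by auto
  then obtain v where v0': "v \<in> S0" and v_max: "\<And>u. u \<in> S0 \<Longrightarrow> l u \<le> l v"
    using ex_max_on[of S0 l] by blast
  \<comment> \<open>Breaking ties by the largest left endpoint makes \<open>v\<close> innermost:
    every neighbor of \<open>v\<close> in \<open>S\<close> has an interval containing that of
    \<open>v\<close>.\<close>
  have v: "v \<in> S" and v_min: "\<And>u. u \<in> S \<Longrightarrow> r v \<le> r u"
    and v_tie: "\<And>u. u \<in> S \<Longrightarrow> r u \<le> r v \<Longrightarrow> l u \<le> l v"
    using v0' v0_min v_max unfolding S0_def by force+
  have vV: "v \<in> V" using v S by blast
  have NV: "x \<in> V" if "x \<in> N u" for x u using that N_subset by blast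
  have adjN: "(l w \<le> l u \<and> r u \<le> r w) \<or> (l u \<le> l w \<and> r w \<le> r u)" if "u \<in> N w" for u w
    using that adj NV N_sym N_irrefl by metis
  have in_N: "u \<in> N w" if "u \<in> V" "w \<in> V" "u \<noteq> w" "l w \<le> l u" "r u \<le> r w" for u w
    using that adj by blast
  have in_N': "u \<in> N w" if "u \<in> V" "w \<in> V" "u \<noteq> w" "l u \<le> l w" "r w \<le> r u" for u w
    using that adj by blast
  have S_far: "l v < l w \<and> r v < r w" if "w \<in> S" "w \<noteq> v" "w \<notin> N v" for w
    using in_N'[of w v] v_tie[of w] v_min[of w] that S vV by force
  \<comment> \<open>The neighbors inside the interval of \<open>v\<close>. All other neighbors
    contain it.\<close>
  define Inn where "Inn = {x \<in> N v - S. l v \<le> l x \<and> r x \<le> r v}"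
  have out: "l x \<le> l v \<and> r v \<le> r x" if "x \<in> N v" "x \<notin> Inn" for x
    using that adjN[of x v] v_min[of x] v_tie[of x] unfolding Inn_def by force
  have far_out: "r w \<le> r x" if "w \<in> N x" "l x \<le> l v" "l v < l w" for w x
    using adjN[OF that(1)] that by auto
  show ?thesis
  proof (cases "Inn = {}")
    case False
    have "finite Inn" unfolding Inn_def using finite_N by simp
    then obtain x2 where x2: "x2 \<in> Inn" and x2_max: "\<And>u. u \<in> Inn \<Longrightarrow> l u \<le> l x2"
      using ex_max_on[OF _ False, of l] by blast
    have x2': "x2 \<in> N v" "x2 \<notin> S" "l v \<le> l x2" "r x2 \<le> r v" "x2 \<in> V"
      using x2 NV unfolding Inn_def by auto
    \<comment> \<open>The neighbor around \<open>v\<close> that reaches furthest right. If there is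
      none, its maximality is vacuous and \<open>x2\<close> serves as a default.\<close>
    obtain x1 where x1: "x1 \<in> N v" and x1_max: "\<And>u. u \<in> N v - Inn \<Longrightarrow>
        x1 \<in> N v - Inn \<and> r u \<le> r x1"
    proof (cases "N v - Inn = {}")
      case True
      then show ?thesis using that[OF x2'(1)] by blast
    next
      case False
      then show ?thesis using ex_max_on[of "N v - Inn" r] that finite_N by (metis Diff_iff finite_Diff)
    qed
    \<comment> \<open>A neighbor of \<open>v\<close> in \<open>S\<close> contains the interval of
      \<open>x2\<close>. A vertex at distance 2 starts and ends strictly right of \<open>v\<close>;
      it contains that of \<open>x2\<close> if reached from inside \<open>v\<close>, and lies within
      that of \<open>x1\<close> if reached from around \<open>v\<close>.\<close>
    have "w \<in> N x1 \<union> N x2" if w: "w \<in> S" "w \<in> near v" for w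
    proof (cases "w \<in> N v")
      case True
      then have "w \<notin> Inn" using w unfolding Inn_def by blast
      then have "l w \<le> l v" "r v \<le> r w" using out True by auto
      then show ?thesis using in_N'[of w x2] x2' w S by force
    next
      case False
      then have w2: "w \<in> N2 v" using w unfolding near_def by blast
      then obtain z where z: "z \<in> N w" "z \<in> N v" "w \<noteq> v" by (rule N2E)
      have far: "l v < l w" "r v < r w" using S_far[OF w(1) z(3) False] by auto
      show ?thesis
      proof (cases "z \<in> Inn")
        case True
        then have "l w \<le> l z" using adjN[OF z(1)] far unfolding Inn_def by auto
        then show ?thesis using x2_max[OF True] in_N'[of w x2] x2' w S far by force
      next
        case False
        then have z': "z \<in> N v - Inn" using z by blast
        then have x1': "x1 \<in> N v - Inn" "r z \<le> r x1" using x1_max by blast+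
        have "r w \<le> r z" using far_out[OF N_sym[OF z(1)]] out[of z] z' far by blast
        moreover have "l x1 \<le> l v" using out x1' by blast
        moreover have "w \<noteq> x1" using x1 \<open>w \<notin> N v\<close> by blast
        ultimately show ?thesis using in_N[of w x1] NV[OF x1] far x1' w S by force
      qed
    qed
    then have "S \<inter> near v \<subseteq> N x1 \<union> N x2" by blast
    moreover have "v \<in> N x1" "v \<in> N x2" using x1 x2' N_sym by blast+
    ultimately show ?thesis using sparse_if_covered v by blast
  next
    case True
    note outer = out[unfolded True, simplified]
    show ?thesis
    proof (cases "N v = {}")
      case True
      then have "near v = {}" unfolding near_def N2_def by blast
      then show ?thesis using v by (intro bexI[of _ v]) auto
    next
      case False
      then obtain x1 where x1: "x1 \<in> N v" and x1_max: "\<And>u. u \<in> N v \<Longrightarrow> r u \<le> r x1"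
        using ex_max_on[OF finite_N, of v r] by blast
      have x1V: "x1 \<in> V" using x1 NV by blast
      show ?thesis
      proof (rule sparse_or_biclique[OF S(1) v x1])
        show "S \<inter> N2 v \<subseteq> N x1"
        proof
          fix w assume w: "w \<in> S \<inter> N2 v"
          then obtain z where z: "z \<in> N w" "z \<in> N v" "w \<noteq> v" "w \<notin> N v" using N2E by blast
          have far: "l v < l w" "r v < r w" using S_far w z by auto
          have "r w \<le> r z" using far_out[OF N_sym[OF z(1)]] outer[OF z(2)] far by blast
          moreover have "w \<noteq> x1" using x1 z by blast
          ultimately show "w \<in> N x1"
            using in_N[of w x1] x1V outer[OF x1] far x1_max[OF z(2)] w S by force
        qed
      next
        fix x y assume sub: "N v \<subseteq> S" "N x1 \<subseteq> S" "N v \<inter> N x1 = {}" and xy: "x \<in> N v" "y \<in> N v"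
        have *: "N x \<inter> N x1 \<subseteq> N y" if "x \<in> N v" "y \<in> N v" "r x \<le> r y" for x y
        proof
          fix w assume w: "w \<in> N x \<inter> N x1"
          show "w \<in> N y"
          proof (cases "w = v")
            case True
            then show ?thesis using that N_sym by blast
          next
            case False
            have w': "w \<notin> N v" "w \<in> S" using w sub by blast+
            have far: "l v < l w" using S_far w' False by blast
            have "r w \<le> r x" using far_out[of w x] w outer[OF that(1)] far by blast
            moreover have "w \<noteq> y" using w' that by blast
            ultimately show ?thesis
              using in_N[of w y] outer[OF that(2)] far that NV[OF that(2)] w' S by force
          qed
        qed
        show "N x \<inter> N x1 \<subseteq> N y \<or> N y \<inter> N x1 \<subseteq> N x"
          using *[OF xy] *[OF xy(2,1)] by linarith
      next
        fix x z assume x: "x \<in> N v" and z: "z \<in> N x" "z \<notin> N v" "z \<notin> N x1"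
        have zv: "z \<noteq> v" using N_sym[OF x1] z by blast
        have zx1: "z \<noteq> x1" using x1 z by blast
        have zV: "z \<in> V" using z(1) NV by blast
        have nz: "\<not> (l z \<le> l v \<and> r v \<le> r z)" "\<not> (l v \<le> l z \<and> r z \<le> r v)"
          using in_N[OF zV vV zv] in_N'[OF zV vV zv] z(2) by blast+
        have zx: "l x \<le> l z" "r z \<le> r x" using adjN[OF z(1)] nz outer[OF x] by auto
        have rz: "r z < r v"
        proof (rule ccontr)
          assume "\<not> r z < r v"
          then have "l v < l z" using nz by auto
          then show False
            using in_N[OF zV x1V zx1] outer[OF x1] zx x1_max[OF x] z(3) by force
        qed
        \<comment> \<open>Since \<open>z\<close> ends before \<open>v\<close> without lying inside
          it, \<open>z\<close> also starts before \<open>v\<close>. A neighbor in \<open>S\<close>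
          ends no earlier than \<open>v\<close>, hence contains \<open>z\<close> and so also
          \<open>v\<close>.\<close>
        have "w \<in> N v" if w: "w \<in> N z" "w \<in> S" for w
        proof -
          have rw: "r v \<le> r w" using w v_min by blast
          then have "l w \<le> l z" using adjN[OF w(1)] rz by auto
          then have "l w < l v" using nz rz by auto
          then show ?thesis using in_N'[of w v] rw w S vV by force
        qed
        then show "z \<notin> S \<and> N z \<inter> S \<subseteq> N v" using rz v_min by force
      qed
    qed
  qed
qed

section \<open>Interval graphs\<close>

text \<open>Let \<open>v\<close> end first in \<open>S\<close> and let its neighbor \<open>x\<close>
  reach furthest right. A close vertex in \<open>S\<close> ends no earlier than \<open>x\<close>
  begins, and begins no later than some neighbor of \<open>v\<close> ends, hence no later than
  \<open>x\<close> ends. So it lies in the closed neighborhood of \<open>x\<close>.\<close>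

lemma interval_sparse:
  fixes l r :: "'a \<Rightarrow> real"
  assumes lr: "\<And>v. v \<in> V \<Longrightarrow> l v \<le> r v"
    and adj: "\<And>u v. u \<in> V \<Longrightarrow> v \<in> V \<Longrightarrow> u \<noteq> v \<Longrightarrow> u \<in> N v \<longleftrightarrow> l u \<le> r v \<and> l v \<le> r u"
    and S: "S \<subseteq> V" "S \<noteq> {}"
  shows "\<exists>x\<in>S. card (S \<inter> near x) \<le> D"
proof -
  have "finite S" using S(1) finite_V finite_subset by blast
  then obtain v where v: "v \<in> S" and v_min: "\<And>u. u \<in> S \<Longrightarrow> r v \<le> r u"
    using ex_min_on[OF _ S(2), of r] by blast
  have vV: "v \<in> V" using v S by blast
  have NV: "x \<in> V" if "x \<in> N u" for x u using that N_subset by blast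
  have adjN: "l u \<le> r w \<and> l w \<le> r u" if "u \<in> N w" for u w
    using that adj NV N_sym N_irrefl by metis
  show ?thesis
  proof (cases "N v = {}")
    case True
    then have "near v = {}" unfolding near_def N2_def by blast
    then show ?thesis using v by (intro bexI[of _ v]) auto
  next
    case False
    then obtain x where x: "x \<in> N v" and x_max: "\<And>u. u \<in> N v \<Longrightarrow> r u \<le> r x"
      using ex_max_on[OF finite_N, of v r] by blast
    have "w \<in> insert x (N x) - {v}" if w: "w \<in> S" "w \<in> near v" for w
    proof -
      have wV: "w \<in> V" and rw: "r v \<le> r w" using w S v_min by auto
      have wv: "w \<noteq> v" using w not_near_self by blast
      obtain z where z: "z \<in> N v" "l w \<le> r z" "w \<in> N v \<or> r v < r z"
      proof (cases "w \<in> N v")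
        case True
        then show ?thesis using that[OF True] lr wV by blast
      next
        case False
        then obtain z where z: "z \<in> N w" "z \<in> N v" using w unfolding near_def N2_def by blast
        then show ?thesis
          using that[OF z(2)] adjN[OF z(1)] False adj[OF wV vV wv] rw lr[OF vV] by force
      qed
      have "l w \<le> r x" using z(2) x_max[OF z(1)] by simp
      moreover have "l x \<le> r w" using adjN[OF x] rw by simp
      ultimately have "w \<noteq> x \<Longrightarrow> w \<in> N x" using adj[OF wV NV[OF x]] by blast
      then show ?thesis using wv by blast
    qed
    then have "S \<inter> near v \<subseteq> insert x (N x) - {v}" by blast
    then show ?thesis using card_closed_neighborhood_minus[OF N_sym[OF x]] v by blast
  qed
qed

section \<open>Cointerval graphs\<close>

text \<open>A vertex of degree at most 1 has at most \<open>D\<close> close vertices. Otherwise,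
  with \<open>v\<close> ending first in \<open>S\<close> and \<open>y\<close> ending first in
  \<open>V\<close>, the close vertices right of \<open>y\<close> are neighbors of \<open>y\<close>.
  The others form \<open>A\<close>, and \<open>insert v A\<close> lies in a common neighborhood, so
  \<open>A\<close> has at most \<open>m - 1\<close> elements.\<close>

lemma cointerval_sparse:
  fixes l r :: "'a \<Rightarrow> real"
  assumes lr: "\<And>v. v \<in> V \<Longrightarrow> l v \<le> r v"
    and adj: "\<And>u v. u \<in> V \<Longrightarrow> v \<in> V \<Longrightarrow> u \<in> N v \<longleftrightarrow> r u < l v \<or> r v < l u"
    and common: "\<And>x y. x \<in> V \<Longrightarrow> y \<in> V \<Longrightarrow> x \<noteq> y \<Longrightarrow> card (N x \<inter> N y) \<le> m"
    and m: "m \<ge> 1"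
    and S: "S \<subseteq> V" "S \<noteq> {}"
  shows "\<exists>x\<in>S. card (S \<inter> near x) \<le> D + m - 1"
proof -
  have NV: "x \<in> V" if "x \<in> N u" for x u using that N_subset by blast
  have adjN: "r u < l w \<or> r w < l u" if "u \<in> N w" for u w
    using that adj NV N_sym by blast
  show ?thesis
  proof (cases "\<exists>v\<in>S. card (N v) \<le> 1")
    case True
    then obtain v where v: "v \<in> S" "card (N v) \<le> 1" by blast
    have "card (near v) \<le> D"
    proof (cases "N v = {}")
      case True
      then have "near v = {}" unfolding near_def N2_def by blast
      then show ?thesis by simp
    next
      case False
      then obtain x where x: "N v = {x}"
        using v(2) finite_N card_1_singletonE
        by (metis One_nat_def card_gt_0_iff le_antisym not_less_eq_eq not_le)
      then have xv: "v \<in> N x" using N_sym by blast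
      have "near v \<subseteq> insert x (N x) - {v}"
      proof
        fix w assume w: "w \<in> near v"
        show "w \<in> insert x (N x) - {v}"
        proof (cases "w \<in> N v")
          case True
          then show ?thesis using x w not_near_self by blast
        next
          case False
          then obtain z where "z \<in> N w" "z \<in> N v" using w unfolding near_def N2_def by blast
          moreover from this have "z = x" using x by simp
          ultimately have "w \<in> N x" using N_sym by blast
          then show ?thesis using w not_near_self by blast
        qed
      qed
      then show ?thesis by (rule card_closed_neighborhood_minus[OF xv])
    qed
    moreover have "card (S \<inter> near v) \<le> card (near v)" by (intro card_mono finite_near) blast
    ultimately show ?thesis using v(1) m by (intro bexI[of _ v]) auto
  next
    case no_leaf: False
    have finS: "finite S" using S(1) finite_V finite_subset by blast
    then obtain v where v: "v \<in> S" and v_min: "\<And>u. u \<in> S \<Longrightarrow> r v \<le> r u"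
      using ex_min_on[OF _ S(2), of r] by blast
    have vV: "v \<in> V" using v S by blast
    then obtain y where y: "y \<in> V" and y_min: "\<And>u. u \<in> V \<Longrightarrow> r y \<le> r u"
      using ex_min_on[OF finite_V, of r] by blast
    define A where "A = {w \<in> S \<inter> N2 v. l w \<le> r y}"
    have right: "r v < l u" if "u \<in> S" "u \<in> N v" for u
      using adjN[OF that(2)] v_min[OF that(1)] lr[OF vV] by auto
    have "S \<inter> near v \<subseteq> N y \<union> A"
    proof
      fix w assume w: "w \<in> S \<inter> near v"
      show "w \<in> N y \<union> A"
      proof (cases "r y < l w")
        case True
        then show ?thesis using adj[of w y] y w S by auto
      next
        case False
        then have "w \<notin> N v" using right[of w] y_min[OF vV] w by auto
        then show ?thesis using w False unfolding A_def near_def by auto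
      qed
    qed
    then have "card (S \<inter> near v) \<le> card (N y \<union> A)"
      using finite_N finS unfolding A_def by (intro card_mono) auto
    also have "\<dots> \<le> card (N y) + card A" by (rule card_Un_le)
    also have "card A \<le> m - 1"
    proof (cases "A = {}")
      case True
      then show ?thesis by simp
    next
      case False
      have finA: "finite A" using finS unfolding A_def by simp
      obtain w0 where w0: "w0 \<in> A" and w0_max: "\<And>u. u \<in> A \<Longrightarrow> r u \<le> r w0"
        using ex_max_on[OF finA False, of r] by blast
      have w0S: "w0 \<in> S" using w0 unfolding A_def by blast
      then have "\<not> card (N w0) \<le> 1" using no_leaf by blast
      then obtain x1 x2 where x: "x1 \<in> N w0" "x2 \<in> N w0" "x1 \<noteq> x2"
        by (metis One_nat_def card_le_Suc0_iff_eq finite_N)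
      \<comment> \<open>The vertex \<open>w0\<close> meets or precedes the point \<open>r y\<close>,
        before which nothing ends, so its neighbors all lie to its right, and thus right of all of
        \<open>A\<close> and of \<open>v\<close>.\<close>
      have xr: "r w0 < l x" if "x \<in> N w0" for x
        using adjN[OF that] w0 y_min[OF NV[OF that]] unfolding A_def by auto
      have "u \<in> N x1 \<inter> N x2" if "u \<in> insert v A" for u
      proof -
        have "u \<in> V" "r u \<le> r w0" using that w0_max vV v_min[OF w0S] S unfolding A_def by auto
        then show ?thesis using adj[of u x1] adj[of u x2] xr x NV by force
      qed
      then have "card (insert v A) \<le> card (N x1 \<inter> N x2)"
        using finite_N by (intro card_mono) auto
      also have "\<dots> \<le> m" using common x NV by blast
      finally have "card (insert v A) \<le> m" .
      moreover have "v \<notin> A" unfolding A_def N2_def by blast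
      ultimately show ?thesis using finA by simp
    qed
    finally have "card (S \<inter> near v) \<le> D + m - 1" using degree[of y] m by simp
    then show ?thesis using v by blast
  qed
qed

section \<open>Circular-arc graphs\<close>

text \<open>A common neighbor of two arcs not containing the point 1 covers one of the two gaps between
  them; in each of the two cases all second neighbors of \<open>v\<close> are neighbors of a single vertex.\<close>

lemma circular_arc_sparse:
  fixes arc :: "'a \<Rightarrow> complex set" and l r :: "'a \<Rightarrow> real"
  assumes arc: "\<And>v. v \<in> V \<Longrightarrow> arc v = circle_arc (a v) (b v)"
    and adj: "\<And>u v. u \<in> V \<Longrightarrow> v \<in> V \<Longrightarrow> u \<noteq> v \<Longrightarrow> u \<in> N v \<longleftrightarrow> arc u \<inter> arc v \<noteq> {}"
    and S: "S \<subseteq> V" "S \<noteq> {}"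
    and lr: "\<And>v. v \<in> S \<Longrightarrow> 0 < l v \<and> l v \<le> r v \<and> r v < 2 * pi \<and> arc v = cis ` {l v..r v}"
  shows "\<exists>x\<in>S. card (S \<inter> near x) \<le> 2 * D"
proof -
  have finS: "finite S" using S(1) finite_V finite_subset by blast
  then obtain v where v: "v \<in> S" and v_min: "\<And>u. u \<in> S \<Longrightarrow> r v \<le> r u"
    using ex_min_on[OF _ S(2), of r] by blast
  have vV: "v \<in> V" using v S by blast
  have NV: "x \<in> V" if "x \<in> N u" for x u using that N_subset by blast
  have meet: "u \<in> insert x (N x)" if "u \<in> V" "x \<in> V" "z \<in> arc u" "z \<in> arc x" for u x z
    using adj that by blast
  have ends: "cis (l u) \<in> arc u" "cis (r u) \<in> arc u" if "u \<in> S" for u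
    using lr[OF that] by auto
  have left: "l u \<le> r v" if u: "u \<in> S" "u \<in> N v" for u
  proof -
    have "u \<noteq> v" "u \<in> V" using u N_irrefl S by auto
    then have "arc u \<inter> arc v \<noteq> {}" using adj u(2) vV by blast
    moreover have "arc u = cis ` {l u..r u}" "arc v = cis ` {l v..r v}"
      using lr[OF u(1)] lr[OF v] by blast+
    ultimately have "\<exists>x\<in>{l u..r u}. \<exists>y\<in>{l v..r v}. cis x = cis y" by auto
    then obtain x y where xy: "x \<in> {l u..r u}" "y \<in> {l v..r v}" "cis x = cis y" by blast
    then have "x = y" using cis_inj_on_period[OF xy(3)] lr[OF u(1)] lr[OF v] by auto
    then show ?thesis using xy by simp
  qed
  have nonadj: "r v < l w" if w: "w \<in> S" "w \<in> N2 v" for w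
  proof (rule ccontr)
    assume "\<not> r v < l w"
    then have "cis (r v) \<in> arc w" using lr[OF w(1)] v_min[OF w(1)] by auto
    then have "w \<in> insert v (N v)" using meet[OF _ vV _ ends(2)[OF v]] w S by blast
    then show False using w unfolding N2_def by blast
  qed
  define T1 where "T1 = {w \<in> S \<inter> N2 v. \<exists>x\<in>N v. cis ` {r v..l w} \<subseteq> arc x}"
  define T2 where "T2 = {w \<in> S \<inter> N2 v. \<exists>x\<in>N v. cis ` {r w..l v + 2 * pi} \<subseteq> arc x}"
  have "w \<in> T1 \<union> T2" if w: "w \<in> S" "w \<in> N2 v" for w
  proof -
    obtain x where x: "x \<in> N w" "x \<in> N v" using w(2) by (rule N2E)
    have xV: "x \<in> V" and wV: "w \<in> V" using x NV w S by auto
    have "x \<noteq> v" "x \<noteq> w" using x N_irrefl by auto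
    then have "arc x \<inter> arc v \<noteq> {}" "arc x \<inter> arc w \<noteq> {}"
      using adj[OF xV vV] adj[OF xV wV] x by blast+
    moreover have "arc v = cis ` {l v..r v}" "arc w = cis ` {l w..r w}"
      using lr[OF v] lr[OF w(1)] by blast+
    ultimately have "\<exists>s\<in>{l v..r v}. cis s \<in> arc x" "\<exists>t\<in>{l w..r w}. cis t \<in> arc x"
      by auto
    then obtain s t where s: "s \<in> {l v..r v}" "cis s \<in> arc x"
        and t: "t \<in> {l w..r w}" "cis t \<in> arc x"
      by blast
    have "cis ` {s..t} \<subseteq> arc x \<or> cis ` {t..s + 2 * pi} \<subseteq> arc x"
      using circle_arc_connects s t arc[OF xV] by simp
    moreover have "{r v..l w} \<subseteq> {s..t}" "{r w..l v + 2 * pi} \<subseteq> {t..s + 2 * pi}" using s t by auto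
    ultimately have "cis ` {r v..l w} \<subseteq> arc x \<or> cis ` {r w..l v + 2 * pi} \<subseteq> arc x" by blast
    then show ?thesis using x w unfolding T1_def T2_def by blast
  qed
  then have "S \<inter> near v \<subseteq> ((S \<inter> N v) \<union> T1) \<union> T2" unfolding near_def by blast
  then have "card (S \<inter> near v) \<le> card (((S \<inter> N v) \<union> T1) \<union> T2)"
    using finS unfolding T1_def T2_def by (intro card_mono) auto
  also have "\<dots> \<le> card ((S \<inter> N v) \<union> T1) + card T2" by (rule card_Un_le)
  \<comment> \<open>Neighbors of \<open>v\<close> in \<open>S\<close> pass through
    \<open>cis (r v)\<close>, where the gap towards \<open>T1\<close> starts. An arc covering the
    longest such gap therefore meets them as well as all of \<open>T1\<close>, so one closed
    neighborhood accounts for both.\<close>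
  also have "card ((S \<inter> N v) \<union> T1) \<le> D"
  proof (cases "T1 = {}")
    case True
    have "card (S \<inter> N v) \<le> card (N v)" by (intro card_mono finite_N) blast
    then show ?thesis using True degree[of v] by simp
  next
    case False
    have "finite T1" using finS unfolding T1_def by simp
    then obtain w1 where w1: "w1 \<in> T1" and w1_max: "\<And>u. u \<in> T1 \<Longrightarrow> l u \<le> l w1"
      using ex_max_on[OF _ False, of l] by blast
    then obtain x where x: "x \<in> N v" "cis ` {r v..l w1} \<subseteq> arc x" unfolding T1_def by blast
    have "u \<in> insert x (N x) - {v}" if u: "u \<in> (S \<inter> N v) \<union> T1" for u
    proof -
      have uS: "u \<in> S" and uv: "u \<noteq> v" using u N_irrefl unfolding T1_def N2_def by auto
      have w1': "r v < l w1" using w1 nonadj unfolding T1_def by blast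
      have "\<exists>y\<in>{r v..l w1}. cis y \<in> arc u"
      proof (cases "u \<in> T1")
        case True
        then have "l u \<in> {r v..l w1}" using w1_max nonadj[of u] unfolding T1_def by force
        then show ?thesis using ends(1)[OF uS] by blast
      next
        case False
        then have "l u \<le> r v" using left u by blast
        then have "cis (r v) \<in> arc u" using lr[OF uS] v_min[OF uS] by auto
        then show ?thesis using w1' by force
      qed
      then have "u \<in> insert x (N x)" using meet[OF _ NV[OF x(1)]] x(2) uS S by blast
      then show ?thesis using uv by blast
    qed
    then show ?thesis using card_closed_neighborhood_minus[OF N_sym[OF x(1)]] by blast
  qed
  also have "card T2 \<le> D"
  proof (cases "T2 = {}")
    case True
    then show ?thesis by simp
  next
    case False
    have "finite T2" using finS unfolding T2_def by simp
    \<comment> \<open>The earliest right endpoint gives the longest gap through the point 1; it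
      contains the right endpoints of all of \<open>T2\<close>.\<close>
    then obtain w2 where w2: "w2 \<in> T2" and w2_min: "\<And>u. u \<in> T2 \<Longrightarrow> r w2 \<le> r u"
      using ex_min_on[OF _ False, of r] by blast
    then obtain x where x: "x \<in> N v" "cis ` {r w2..l v + 2 * pi} \<subseteq> arc x" unfolding T2_def by blast
    have "u \<in> insert x (N x) - {v}" if u: "u \<in> T2" for u
    proof -
      have uS: "u \<in> S" and uv: "u \<noteq> v" using u unfolding T2_def N2_def by auto
      have "r u \<in> {r w2..l v + 2 * pi}" using w2_min[OF u] lr[OF uS] lr[OF v] by auto
      then have "cis (r u) \<in> arc x" using x(2) by blast
      then have "u \<in> insert x (N x)" using meet[OF _ NV[OF x(1)] ends(2)[OF uS]] uS S by blast
      then show ?thesis using uv by blast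
    qed
    then show ?thesis using card_closed_neighborhood_minus[OF N_sym[OF x(1)]] by blast
  qed
  finally show ?thesis using v by (intro bexI[of _ v]) auto
qed

lemma circular_arc_labeling:
  fixes a b :: "'a \<Rightarrow> real"
  assumes "p \<ge> 1" "q \<ge> 1"
    and ab: "\<And>v. v \<in> V \<Longrightarrow> a v \<le> b v"
    and adj: "\<And>u v. u \<in> V \<Longrightarrow> v \<in> V \<Longrightarrow> u \<noteq> v \<Longrightarrow>
      u \<in> N v \<longleftrightarrow> circle_arc (a u) (b u) \<inter> circle_arc (a v) (b v) \<noteq> {}"
  shows "\<exists>f. f ` V \<subseteq> {..3 * max p q * D + p} \<and> labels_on V p q f"
proof (cases "D = 0")
  \<comment> \<open>Without edges, an arc through 1 placed on top would get the label
    \<open>max p q\<close>, which may exceed the bound \<open>p\<close>.\<close>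
  case True
  then have "N v = {}" for v using degree[of v] finite_N by simp
  then have "labels_on V p q (\<lambda>_. 0)" unfolding labels_on_def separated_def N2_def by blast
  then show ?thesis by (intro exI[of _ "\<lambda>_. 0"]) auto
next
  case False
  define arc where "arc v = circle_arc (a v) (b v)" for v
  define K where "K = {v \<in> V. 1 \<in> arc v}"
  define M where "M = max p q"
  have finK: "finite K" unfolding K_def using finite_V by simp
  have clique: "u \<in> N v" if "u \<in> K" "v \<in> K" "u \<noteq> v" for u v
    using that adj unfolding K_def arc_def by blast
  have "\<exists>l r. 0 < l \<and> l \<le> r \<and> r < 2 * pi \<and> arc v = cis ` {l..r}" if "v \<in> V - K" for v
    by (rule circle_arc_avoiding_one[of "a v" "b v"]) (use ab that in \<open>auto simp: K_def arc_def\<close>)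
  then obtain l r where lr: "\<And>v. v \<in> V - K \<Longrightarrow>
      0 < l v \<and> l v \<le> r v \<and> r v < 2 * pi \<and> arc v = cis ` {l v..r v}"
    by metis
  have "\<exists>f. f ` (V - K) \<subseteq> {..max p q * (2 * D)} \<and> labels_on (V - K) p q f"
  proof (rule multiples_labeling)
    show "finite (V - K)" using finite_V by blast
    show "1 \<le> max p q" using assms by simp
    show "\<exists>v\<in>S. card (S \<inter> near v) \<le> 2 * D" if "S \<subseteq> V - K" "S \<noteq> {}" for S
    proof (rule circular_arc_sparse[OF arc_def _ _ that(2), where l = l and r = r])
      show "u \<in> N v \<longleftrightarrow> arc u \<inter> arc v \<noteq> {}" if "u \<in> V" "v \<in> V" "u \<noteq> v" for u v
        unfolding arc_def by (rule adj[OF that])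
      show "S \<subseteq> V" using that(1) by blast
      show "0 < l v \<and> l v \<le> r v \<and> r v < 2 * pi \<and> arc v = cis ` {l v..r v}" if "v \<in> S" for v
        using lr[of v] that \<open>S \<subseteq> V - K\<close> by blast
    qed
  qed
  then obtain f where f: "f ` (V - K) \<subseteq> {..M * (2 * D)}" "labels_on (V - K) p q f"
    unfolding M_def by blast
  have cardK: "card K \<le> Suc D"
  proof (cases "K = {}")
    case False
    then obtain k where k: "k \<in> K" by blast
    have "card K \<le> card (insert k (N k))"
      using clique k finite_N by (intro card_mono) auto
    then show ?thesis using degree[of k] finite_N N_irrefl by simp
  qed simp
  obtain h where h: "bij_betw h K {0..<card K}" using ex_bij_betw_finite_nat[OF finK] by blast
  have h_le: "h v \<le> D" if "v \<in> K" for v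
    using bij_betwE[OF h] that cardK by force
  have h_inj: "h u \<noteq> h v" if "u \<in> K" "v \<in> K" "u \<noteq> v" for u v
    using h that unfolding bij_betw_def inj_on_def by blast
  \<comment> \<open>The offset \<open>M\<close> separates the clique from all labels below. Inside
    the clique all pairs are adjacent, so spacing \<open>p\<close> suffices.\<close>
  define g where "g v = (if v \<in> K then M * (2 * D) + M + p * h v else f v)" for v
  have mixed: "separated p q u v (g u) (g v)" if "u \<in> K" "v \<in> V - K" for u v
  proof (rule separatedI)
    have "f v \<le> M * (2 * D)" using f(1) that by blast
    moreover have "g u = M * (2 * D) + M + p * h u" "g v = f v" using that unfolding g_def by auto
    ultimately have "g v + M \<le> g u" by linarith
    then show "int (max p q) \<le> \<bar>int (g u) - int (g v)\<bar>" unfolding M_def by linarith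
  qed
  have "separated p q u v (g u) (g v)" if uv: "u \<in> V" "v \<in> V" for u v
  proof (cases "u \<in> K \<longleftrightarrow> v \<in> K")
    case False
    then show ?thesis using mixed separated_sym uv by blast
  next
    case same: True
    show ?thesis
    proof (cases "u \<in> K \<and> u \<noteq> v")
      case True
      then have K: "u \<in> K" "v \<in> K" "v \<in> N u" using same clique by auto
      have "int p * 1 \<le> int p * \<bar>int (h u) - int (h v)\<bar>"
        using h_inj[OF K(1,2)] True by (intro mult_left_mono) auto
      also have "\<dots> = \<bar>int (g u) - int (g v)\<bar>"
        using K unfolding g_def by (simp add: abs_mult flip: right_diff_distrib)
      finally show ?thesis using K unfolding separated_def N2_def by simp
    next
      case False
      then show ?thesis
        using same uv f(2) separated_trivial[OF not_near_self] unfolding labels_on_def g_def by auto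
    qed
  qed
  then have "labels_on V p q g" unfolding labels_on_def by blast
  moreover have "g v \<le> 3 * M * D + p" if "v \<in> V" for v
  proof (cases "v \<in> K")
    case True
    obtain D' where D': "D = Suc D'" using False by (cases D) auto
    \<comment> \<open>The clique has at most \<open>D + 1\<close> vertices, numbered from 0. Trading
      \<open>D - 1\<close> of the \<open>D\<close> steps of size \<open>p\<close> for steps of size
      \<open>M\<close> leaves the extra \<open>p\<close> in the bound.\<close>
    have "p * h v \<le> p * D" using h_le[OF True] by simp
    also have "\<dots> = p * D' + p" unfolding D' by simp
    also have "\<dots> \<le> M * D' + p" unfolding M_def by (intro add_mono mult_le_mono) auto
    finally have "M * (2 * D) + M + p * h v \<le> 3 * M * D + p" unfolding D' by (simp add: algebra_simps)
    then show ?thesis using True unfolding g_def by simp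
  next
    case False
    then have "f v \<le> M * (2 * D)" using f(1) that by blast
    also have "\<dots> \<le> 3 * M * D" by simp
    finally show ?thesis using False unfolding g_def by simp
  qed
  then have "g ` V \<subseteq> {..3 * M * D + p}" by blast
  ultimately show ?thesis unfolding M_def by blast
qed

end

section \<open>Distances, graph parameters and the five bounds\<close>

text \<open>The empty walk and a single arc would be too short. Conversely, an infimum of 2 lies
  below 3, so some walk has length less than 3, hence exactly 2.\<close>

lemma (in pair_graph) graph_dist_eq_2:
  assumes "u \<in> pverts G" and dist: "graph_dist G u v = 2"
  shows "u \<noteq> v" "(u, v) \<notin> parcs G" "\<exists>x. (u, x) \<in> parcs G \<and> (x, v) \<in> parcs G"
proof -
  let ?len = "\<lambda>es. awalk_cost (\<lambda>_. 1) es"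
  have len: "?len es = real (length es)" for es
    by (induction es) auto
  have ge: "2 \<le> length es" if "awalk u es v" for es
  proof -
    have "(2::ereal) \<le> ereal (?len es)"
      using min_cost_le_walk_cost[OF that, of "\<lambda>_. 1"] dist unfolding graph_dist_def by simp
    then have "ereal 2 \<le> ereal (real (length es))" unfolding len by simp
    then show ?thesis by simp
  qed
  show "u \<noteq> v" using ge[of "[]"] assms(1) by (auto simp: awalk_Nil_iff)
  show "(u, v) \<notin> parcs G"
  proof
    assume "(u, v) \<in> parcs G"
    then have "awalk u [(u, v)] v" by (auto simp: awalk_simps dest: wellformed'(2))
    then show False using ge[of "[(u, v)]"] by simp
  qed
  have "(INF es\<in>{es. awalk u es v}. ereal (?len es)) < ereal 3"
    using dist unfolding graph_dist_def \<mu>_def by simp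
  then obtain es where es: "awalk u es v" "ereal (?len es) < ereal 3"
    unfolding INF_less_iff by blast
  then have "length es = 2" using ge[OF es(1)] unfolding len by simp
  then obtain e e' where "es = [e, e']" by (auto simp: numeral_2_eq_2 length_Suc_conv)
  then show "\<exists>x. (u, x) \<in> parcs G \<and> (x, v) \<in> parcs G"
    using es(1) by (cases e; cases e') (auto simp: awalk_simps)
qed

lemma L_number_le:
  assumes "L_labeling p q G f" "f ` pverts G \<subseteq> {..k}"
  shows "L_number p q G \<le> k"
proof -
  have "L_number p q G \<le> label_span G f"
    unfolding L_number_def using assms(1) by (intro Least_le) blast
  also have "\<dots> \<le> Sup (f ` pverts G)" unfolding label_span_def by simp
  also have "\<dots> \<le> k"
    using assms(2) by (cases "pverts G = {}") (auto intro: cSup_least)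
  finally show ?thesis .
qed

lemma pair_graph_bounded_degree:
  assumes "pair_graph G"
  shows "bounded_degree_graph (pverts G) (neighbors G) (max_degree G)"
proof -
  interpret pair_graph G by fact
  show ?thesis
  proof
    show "finite (pverts G)" by (rule pair_finite_verts)
    show "neighbors G v \<subseteq> pverts G" for v unfolding neighbors_def using wellformed' by blast
    show "v \<in> neighbors G u" if "u \<in> neighbors G v" for u v
      using that pair_sym_arcs unfolding neighbors_def symmetric_def by (auto dest: symD)
    show "v \<notin> neighbors G v" for v
      unfolding neighbors_def using pair_no_loops by force
    show "card (neighbors G v) \<le> max_degree G" for v
    proof (cases "v \<in> pverts G")
      case True
      then show ?thesis unfolding max_degree_def
        using pair_finite_verts by (intro le_cSup_finite) auto
    next
      case False
      then have "neighbors G v = {}" unfolding neighbors_def using wellformed' by blast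
      then show ?thesis by simp
    qed
  qed
qed

lemma finite_common_neighbor_numbers:
  assumes "finite (pverts G)"
  shows "finite {num_common_neighbors G u v | u v. u \<in> pverts G \<and> v \<in> pverts G \<and> u \<noteq> v}"
proof (rule finite_subset)
  show "{num_common_neighbors G u v | u v. u \<in> pverts G \<and> v \<in> pverts G \<and> u \<noteq> v}
      \<subseteq> (\<lambda>(u, v). num_common_neighbors G u v) ` (pverts G \<times> pverts G)"
    by auto
  show "finite \<dots>" using assms by simp
qed

lemma multiplicity_le_max_degree:
  assumes "pair_graph G"
  shows "multiplicity_graph G \<le> max_degree G"
proof -
  interpret bounded_degree_graph "pverts G" "neighbors G" "max_degree G"
    using assms by (rule pair_graph_bounded_degree)
  have "num_common_neighbors G u v \<le> max_degree G" for u v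
    unfolding num_common_neighbors_def
    using card_mono[OF finite_N, of "neighbors G u \<inter> neighbors G v" u] degree[of u] by simp
  then have le: "k \<le> max_degree G"
    if "k \<in> {num_common_neighbors G u v | u v. u \<in> pverts G \<and> v \<in> pverts G \<and> u \<noteq> v}" (is "k \<in> ?X")
    for k
    using that by blast
  show ?thesis
  proof (cases "?X = {}")
    case True
    then show ?thesis unfolding multiplicity_graph_def by (simp only: Sup_nat_empty le0)
  next
    case False
    then show ?thesis unfolding multiplicity_graph_def by (rule cSup_least) (rule le)
  qed
qed

lemma Icc_Int_Icc_nonempty:
  fixes a b c d :: real
  assumes "a \<le> b" "c \<le> d"
  shows "{a..b} \<inter> {c..d} \<noteq> {} \<longleftrightarrow> a \<le> d \<and> c \<le> b"
  using assms by auto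

text \<open>In both cases the right side minus the left side is a sum of two nonnegative products.
  For \<open>p \<le> q\<close> the factor \<open>2 * p - 1 - q\<close> needs
  \<open>q < 2 * p\<close>; otherwise \<open>D - (m - 1)\<close> needs
  \<open>m \<le> D\<close>.\<close>

lemma weights_bound:
  fixes p q D m :: int
  assumes "1 \<le> p" "1 \<le> q" "q < 2 * p" "1 \<le> m" "m \<le> D"
  shows "max p q * (D + m - 1) \<le> (2 * p - 1) * D + (2 * q - 1) * (m - 1)"
proof (cases "p \<le> q")
  case True
  have "0 \<le> (2 * p - 1 - q) * D" "0 \<le> (q - 1) * (m - 1)" using assms by simp_all
  then show ?thesis using True by (simp add: max_def algebra_simps)
next
  case False
  have "0 \<le> (p - 1) * (D - (m - 1))" "0 \<le> (2 * q - 2) * (m - 1)" using assms by simp_all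
  then show ?thesis using False by (simp add: max_def algebra_simps)
qed

text \<open>For \<open>\<Delta> = 0\<close> the first and fourth bounds would be negative. For
  \<open>\<mu> = 0\<close> the last bound fails for a single edge with \<open>p = q = 1\<close>, and
  for \<open>q \<ge> 2 * p\<close> it fails for stars with more than \<open>2 * p\<close> leaves,
  whose leaves are pairwise at distance 2.\<close>

theorem theorem1:
  fixes G :: "'a pair_pre_digraph" and p q :: nat and \<Delta> \<mu> :: int
  assumes "pair_graph G"
    and "p \<ge> 1" and "q \<ge> 1"
    and "\<Delta> = int (max_degree G)"
    and "\<mu> = int (multiplicity_graph G)"
  shows
    "(\<forall>k. interval_k_graph k G \<and> \<Delta> \<ge> 1 \<longrightarrow>
        int (L_number p q G) \<le> 2 * (int p + int q - 1) * \<Delta> - 2 * int q + 1) \<and>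
     (interval_graph G \<longrightarrow>
        int (L_number p q G) \<le> max (int p) (int q) * \<Delta>) \<and>
     (circular_arc_graph G \<longrightarrow>
        int (L_number p q G) \<le> 3 * max (int p) (int q) * \<Delta> + int p) \<and>
     (permutation_graph G \<and> \<Delta> \<ge> 1 \<longrightarrow>
        int (L_number p q G) \<le> 2 * (int p + int q - 1) * \<Delta> - 2 * int q + 1) \<and>
     (cointerval_graph G \<and> \<mu> \<ge> 1 \<and> q < 2 * p \<longrightarrow>
        int (L_number p q G) \<le> (2 * int p - 1) * \<Delta> + (2 * int q - 1) * (\<mu> - 1))"
proof -
  define D where "D = max_degree G"
  define m where "m = multiplicity_graph G"
  interpret pair_graph G by fact
  interpret B: bounded_degree_graph "pverts G" "neighbors G" D
    unfolding D_def using assms(1) by (rule pair_graph_bounded_degree)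
  have pq1: "1 \<le> max p q" using assms(2) by simp
  have \<Delta>: "\<Delta> = int D" and \<mu>: "\<mu> = int m" unfolding D_def m_def by (fact assms)+
  have nbr: "u \<in> neighbors G v \<longleftrightarrow> (u, v) \<in> parcs G" for u v
    using B.N_sym unfolding neighbors_def by blast
  have L: "L_number p q G \<le> k" if f: "f ` pverts G \<subseteq> {..k}" "B.labels_on (pverts G) p q f" for f k
  proof (rule L_number_le[OF _ f(1)])
    show "L_labeling p q G f"
      unfolding L_labeling_def
    proof (intro ballI conjI impI)
      fix u v assume uv: "u \<in> pverts G" "v \<in> pverts G"
      then have sep: "B.separated p q u v (f u) (f v)" using f(2) unfolding B.labels_on_def by blast
      show "int p \<le> \<bar>int (f u) - int (f v)\<bar>" if "(u, v) \<in> parcs G"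
        using sep that unfolding B.separated_def neighbors_def by blast
      show "int q \<le> \<bar>int (f u) - int (f v)\<bar>" if d: "graph_dist G u v = 2"
      proof -
        have "v \<in> B.N2 u"
          using graph_dist_eq_2[OF uv(1) d] nbr B.N_sym unfolding B.N2_def by blast
        then show ?thesis using sep unfolding B.separated_def by blast
      qed
    qed
  qed
  have biclique: "int (L_number p q G) \<le> 2 * (int p + int q - 1) * \<Delta> - 2 * int q + 1"
    if "\<Delta> \<ge> 1" and sparse: "\<And>S. S \<subseteq> pverts G \<Longrightarrow> S \<noteq> {} \<Longrightarrow>
      \<exists>x\<in>S. card (S \<inter> B.near x) \<le> 2 * D - 2 \<or> x \<in> B.biclique_part"
  proof -
    have "D \<ge> 1" using that(1) \<Delta> by simp
    then have "L_number p q G \<le> (2 * p - 1) * D + (2 * q - 1) * (D - 1)"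
      by (rule exE[OF B.biclique_labeling[OF assms(2,3) _ sparse]]) (assumption | elim conjE, rule L)+
    then have "int (L_number p q G) \<le> int ((2 * p - 1) * D + (2 * q - 1) * (D - 1))"
      by (simp only: of_nat_le_iff)
    also have "\<dots> = 2 * (int p + int q - 1) * \<Delta> - 2 * int q + 1"
    proof -
      have "int (2 * p - 1) = 2 * int p - 1" "int (2 * q - 1) = 2 * int q - 1"
        "int (D - 1) = int D - 1"
        using assms(2,3) \<open>D \<ge> 1\<close> by (simp_all add: of_nat_diff)
      then show ?thesis by (simp only: of_nat_add of_nat_mult \<Delta>) (simp add: algebra_simps)
    qed
    finally show ?thesis .
  qed
  have multiples: "int (L_number p q G) \<le> max (int p) (int q) * int d"
    if "\<And>S. S \<subseteq> pverts G \<Longrightarrow> S \<noteq> {} \<Longrightarrow> \<exists>x\<in>S. card (S \<inter> B.near x) \<le> d" for d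
  proof -
    have "L_number p q G \<le> max p q * d"
      by (rule exE[OF B.multiples_labeling[OF B.finite_V pq1 that]]) (assumption | elim conjE, rule L)+
    then have "int (L_number p q G) \<le> int (max p q * d)" by (simp only: of_nat_le_iff)
    then show ?thesis by (simp only: of_nat_max of_nat_mult)
  qed
  have 1: "int (L_number p q G) \<le> 2 * (int p + int q - 1) * \<Delta> - 2 * int q + 1"
    if model: "interval_k_graph k G" and "\<Delta> \<ge> 1" for k
  proof -
    obtain l r :: "'a \<Rightarrow> real" and \<kappa> :: "'a \<Rightarrow> nat" where
      lr: "\<And>v. v \<in> pverts G \<Longrightarrow> l v \<le> r v" and
      adj: "\<And>u v. u \<in> pverts G \<Longrightarrow> v \<in> pverts G \<Longrightarrow>
        (u, v) \<in> parcs G \<longleftrightarrow> {l u..r u} \<inter> {l v..r v} \<noteq> {} \<and> \<kappa> u \<noteq> \<kappa> v"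
      using model unfolding interval_k_graph_def by blast
    show ?thesis
    proof (rule biclique[OF that(2)], rule B.interval_k_sparse[of l r \<kappa>])
      show "u \<in> neighbors G v \<longleftrightarrow> l u \<le> r v \<and> l v \<le> r u \<and> \<kappa> u \<noteq> \<kappa> v"
        if "u \<in> pverts G" "v \<in> pverts G" for u v
        using adj[OF that] Icc_Int_Icc_nonempty[OF lr[OF that(1)] lr[OF that(2)]] nbr[of u v]
        by blast
    qed (use lr in blast)+
  qed
  have 2: "int (L_number p q G) \<le> max (int p) (int q) * \<Delta>" if model: "interval_graph G"
  proof -
    obtain l r :: "'a \<Rightarrow> real" where
      lr [rule_format]: "\<forall>v\<in>pverts G. l v \<le> r v" and
      adj [rule_format]: "\<forall>u\<in>pverts G. \<forall>v\<in>pverts G. u \<noteq> v \<longrightarrow>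
        ((u, v) \<in> parcs G \<longleftrightarrow> {l u..r u} \<inter> {l v..r v} \<noteq> {})"
      using model unfolding interval_graph_def by (elim exE conjE) (rule that)
    show ?thesis unfolding \<Delta>
    proof (rule multiples, rule B.interval_sparse[of l r])
      show "u \<in> neighbors G v \<longleftrightarrow> l u \<le> r v \<and> l v \<le> r u"
        if "u \<in> pverts G" "v \<in> pverts G" "u \<noteq> v" for u v
        using adj[OF that] Icc_Int_Icc_nonempty[OF lr[OF that(1)] lr[OF that(2)]] nbr[of u v]
        by blast
    qed (use lr in blast)+
  qed
  have 3: "int (L_number p q G) \<le> 3 * max (int p) (int q) * \<Delta> + int p" if model: "circular_arc_graph G"
  proof -
    obtain a b :: "'a \<Rightarrow> real" where
      ab [rule_format]: "\<forall>v\<in>pverts G. a v \<le> b v" and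
      adj [rule_format]: "\<forall>u\<in>pverts G. \<forall>v\<in>pverts G. u \<noteq> v \<longrightarrow>
        ((u, v) \<in> parcs G \<longleftrightarrow> circle_arc (a u) (b u) \<inter> circle_arc (a v) (b v) \<noteq> {})"
      using model unfolding circular_arc_graph_def by (elim exE conjE) (rule that)
    have "L_number p q G \<le> 3 * max p q * D + p"
    proof (rule exE[OF B.circular_arc_labeling[OF assms(2,3) ab]])
      show "u \<in> neighbors G v \<longleftrightarrow> circle_arc (a u) (b u) \<inter> circle_arc (a v) (b v) \<noteq> {}"
        if "u \<in> pverts G" "v \<in> pverts G" "u \<noteq> v" for u v
        using adj[OF that] nbr by blast
    qed (assumption | elim conjE, rule L)+
    then have "int (L_number p q G) \<le> int (3 * max p q * D + p)" by (simp only: of_nat_le_iff)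
    then show ?thesis by (simp only: \<Delta> of_nat_max of_nat_mult of_nat_add of_nat_numeral)
  qed
  have 4: "int (L_number p q G) \<le> 2 * (int p + int q - 1) * \<Delta> - 2 * int q + 1"
    if model: "permutation_graph G" and "\<Delta> \<ge> 1"
  proof -
    obtain l r :: "'a \<Rightarrow> real" where
      lr [rule_format]: "\<forall>v\<in>pverts G. l v \<le> r v" and
      adj [rule_format]: "\<forall>u\<in>pverts G. \<forall>v\<in>pverts G. u \<noteq> v \<longrightarrow>
        ((u, v) \<in> parcs G \<longleftrightarrow> {l u..r u} \<subseteq> {l v..r v} \<or> {l v..r v} \<subseteq> {l u..r u})"
      using model unfolding permutation_graph_def by (elim exE conjE) (rule that)
    show ?thesis
    proof (rule biclique[OF that(2)], rule B.permutation_sparse[of l r])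
      show "u \<in> neighbors G v \<longleftrightarrow> (l v \<le> l u \<and> r u \<le> r v) \<or> (l u \<le> l v \<and> r v \<le> r u)"
        if "u \<in> pverts G" "v \<in> pverts G" "u \<noteq> v" for u v
        using adj[OF that] lr[OF that(1)] lr[OF that(2)] nbr[of u v] by simp
    qed
  qed
  have 5: "int (L_number p q G) \<le> (2 * int p - 1) * \<Delta> + (2 * int q - 1) * (\<mu> - 1)"
    if model: "cointerval_graph G" and "\<mu> \<ge> 1" "q < 2 * p"
  proof -
    obtain l r :: "'a \<Rightarrow> real" where
      lr [rule_format]: "\<forall>v\<in>pverts G. l v \<le> r v" and
      adj [rule_format]: "\<forall>u\<in>pverts G. \<forall>v\<in>pverts G. u \<noteq> v \<longrightarrow>
        ((u, v) \<notin> parcs G \<longleftrightarrow> {l u..r u} \<inter> {l v..r v} \<noteq> {})"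
      using model unfolding cointerval_graph_def interval_graph_def graph_complement_def
      by (elim exE conjE) (rule that; force)
    have "1 \<le> m" using that(2) \<mu> by simp
    have "int (L_number p q G) \<le> max (int p) (int q) * int (D + m - 1)"
    proof (rule multiples, rule B.cointerval_sparse[of l r m])
      show "u \<in> neighbors G v \<longleftrightarrow> r u < l v \<or> r v < l u"
        if "u \<in> pverts G" "v \<in> pverts G" for u v
      proof (cases "u = v")
        case True
        then show ?thesis using B.N_irrefl lr[OF that(1)] by simp
      next
        case False
        then show ?thesis
          using adj[OF that False] Icc_Int_Icc_nonempty[OF lr[OF that(1)] lr[OF that(2)]] nbr[of u v]
          by (metis not_le)
      qed
      show "card (neighbors G x \<inter> neighbors G y) \<le> m"
        if "x \<in> pverts G" "y \<in> pverts G" "x \<noteq> y" for x y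
        unfolding m_def multiplicity_graph_def num_common_neighbors_def[symmetric]
        using that by (intro le_cSup_finite finite_common_neighbor_numbers B.finite_V) blast
    qed (use lr \<open>1 \<le> m\<close> in blast)+
    also have "int (D + m - 1) = \<Delta> + \<mu> - 1" using \<open>1 \<le> m\<close> by (simp add: \<Delta> \<mu> of_nat_diff)
    also have "max (int p) (int q) * (\<Delta> + \<mu> - 1) \<le> (2 * int p - 1) * \<Delta> + (2 * int q - 1) * (\<mu> - 1)"
      using assms that multiplicity_le_max_degree[OF assms(1)] by (intro weights_bound) auto
    finally show ?thesis .
  qed
  show ?thesis
    by (intro conjI allI impI; (elim conjE)?; fact 1 2 3 4 5)
qed

end
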